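(* Let $R$ be a 2-fir and let $f\in\mathcal F$. Then the following are equivalent: (i) $f$ is fully reducible. (ii) $rk\,V(f)=\ell(f)$. (iii) If $V(f)=\bigcup_{i=1}^r(V(f)\cap\Delta(q_i))$ is the decomposition of $V(f)$ into similarity classes ($q_1,\dots,q_r$ being pairwise non-similar atoms representing the similarity classes that $V(f)$ intersects), then $\ell(f)=\sum_{i=1}^r\dim_{C(q_i)}\ker(\lambda_{f,q_i})$, where $C(q_i)=\mathrm{End}_R(R/Rq_i)$ is a division ring. (iv) There exist atoms $p_1,\dots,p_n$ such that $R/Rf\cong\bigoplus_{i=1}^nR/Rp_i$ as left $R$-modules. (v) All factors of $f$ are fully reducible. (vi) Every product of two neighbouring factors of $f$ is fully reducible. (vii) Every product of two neighbouring atomic factors of $f$ is fully reducible. (viii) For every nonzero $g\in R$, if $V(f)\subseteq V(g)$ then $g\in Rf$.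
   Context: Rings are associative with $1$, not necessarily commutative. A 2-fir is a domain $R$ such that for all $a,b\in R$ with $aR\cap bR\neq 0$ there are $c,d\in R$ with $aR\cap bR=cR$ and $aR+bR=dR$ (this condition is left-right symmetric). $U(R)$ is the group of units. An atom is a nonzero non-unit that is not a product of two non-units; $\mathcal A$ is the set of atoms. The length $\ell(a)$ of $a$ is the least $n$ such that $a$ is a product of $n$ atoms, $0$ if $a$ is a unit, and $\infty$ if $a$ is neither a unit nor a finite product of atoms; $\mathcal F=\{x\in R: \ell(x)<\infty\}$ (so $0\notin\mathcal F$, $U(R)\subseteq\mathcal F$). Nonzero elements $a,a'$ are similar if $R/Ra\cong R/Ra'$ as left $R$-modules; $\Delta(a)$ denotes the similarity class of $a$. The intersection of an empty family of left ideals is $R$. An element $f\in\mathcal F$ is fully reducible if there are finitely many atoms $p_1,\dots,p_n\in R$ with $Rf=\bigcap_{i=1}^nRp_i$ ($n=0$ allowed, so units are fully reducible; likewise $n=0$ is allowed in (iv)). A factor of $f$ is an element $g\in R\setminus U(R)$ such that $f=pgq$ for some $p,q\in R$. Factors $g,h$ of $f$ are neighbouring if there are $p,q\in R$ with $f=pghq$. For an atom $p$, $C(p):=\mathrm{End}_R(R/Rp)$; endomorphisms are written on the right of their arguments, so that $R/Rp$ is a right $C(p)$-vector space. For $f\in R$, $\lambda_{f,p}:R/Rp\to R/Rp$ is the right $C(p)$-linear map $x+Rp\mapsto fx+Rp$. A subset $\Delta\subseteq\mathcal F\setminus U(R)$ is $F$-algebraic if $\bigcap_{\delta\in\Delta}R\delta\neq0$.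 For $\Delta$ $F$-algebraic, $d\in\mathcal F$ is $F$-dependent on $\Delta$ if $\Delta\cup\{d\}$ is $F$-algebraic and there is a finite subset $\Gamma\subseteq\Delta$ with $Rd+\bigcap_{\gamma\in\Gamma}R\gamma\neq R$. $\Delta$ is $F$-independent if no $\delta\in\Delta$ is $F$-dependent on $\Delta\setminus\{\delta\}$. An $F$-basis of $\Delta$ is an $F$-independent subset $B\subseteq\Delta$ such that every element of $\Delta$ is $F$-dependent on $B$. For an $F$-algebraic set $\Delta$ of atoms, $rk(\Delta)=|B|$ for any $F$-basis $B$ of $\Delta$ (every such $\Delta$ has an $F$-basis, and all $F$-bases have the same cardinality). For $a\in R\setminus\{0\}$, $V(a)=\{p\in\mathcal A: a\in Rp\}$, an $F$-algebraic set. *)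

theory Defs
  imports "HOL-Algebra.Module" "HOL-Library.Set_Algebras" "HOL-Library.Extended_Nat"
begin

text \<open>
  The ring \<open>R\<close> is a type. Derived structures (modules over \<open>R\<close>, endomorphism rings) are records
  of \<open>HOL-Algebra\<close>; \<open>R\<close> is not assumed commutative, so the locale \<open>module\<close> does not apply
  and only the record type of that name is used.
\<close>

section \<open>2-firs, atoms, length\<close>

class two_fir = ring_1_no_zero_divisors +
  assumes two_fir:
    "range ((*) a) \<inter> range ((*) b) \<noteq> {0} \<Longrightarrow>
      \<exists>c d. range ((*) a) \<inter> range ((*) b) = range ((*) c) \<and>
            {a * x + b * y | x y. True} = range ((*) d)"

definition ring_units :: "'a::ring_1 set" where
  "ring_units = {u. \<exists>v. u * v = 1 \<and> v * u = 1}"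

definition atoms :: "'a::ring_1 set" where
  "atoms = {a. a \<noteq> 0 \<and> a \<notin> ring_units \<and>
              \<not> (\<exists>b c. a = b * c \<and> b \<notin> ring_units \<and> c \<notin> ring_units)}"

text \<open>\<open>Inf {} = \<infinity>\<close> on \<open>enat\<close> covers the elements that are not products of atoms.\<close>

definition atom_length :: "'a::ring_1 \<Rightarrow> enat" where
  "atom_length a =
    (if a \<in> ring_units then 0
     else Inf {enat (length ps) | ps. set ps \<subseteq> atoms \<and> prod_list ps = a})"

definition finite_length :: "'a::ring_1 set" where
  "finite_length = {x. atom_length x < \<infinity>}"

definition left_ideal_of :: "'a::ring_1 \<Rightarrow> 'a set" where
  "left_ideal_of a = {r * a | r. True}"

section \<open>Left modules\<close>

text \<open>
  Hom-sets between left modules; the scalars range over the whole type \<open>'r\<close>. Maps are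
  restricted to the carrier so that equal homomorphisms are equal functions.
\<close>

definition lmod_hom :: "('r, 'm) module \<Rightarrow> ('r, 'n) module \<Rightarrow> ('m \<Rightarrow> 'n) set" where
  "lmod_hom M N =
    {h \<in> carrier M \<rightarrow>\<^sub>E carrier N.
       (\<forall>x\<in>carrier M. \<forall>y\<in>carrier M. h (x \<oplus>\<^bsub>M\<^esub> y) = h x \<oplus>\<^bsub>N\<^esub> h y) \<and>
       (\<forall>r. \<forall>x\<in>carrier M. h (r \<odot>\<^bsub>M\<^esub> x) = r \<odot>\<^bsub>N\<^esub> h x)}"

definition lmod_iso :: "('r, 'm) module \<Rightarrow> ('r, 'n) module \<Rightarrow> bool" where
  "lmod_iso M N \<longleftrightarrow> (\<exists>h\<in>lmod_hom M N. bij_betw h (carrier M) (carrier N))"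

text \<open>
  The quotient \<open>R/Ra\<close>, with cosets \<open>x + Ra\<close> as elements. The multiplicative fields of the
  record are irrelevant. The operations are \<open>(x + Ra) + (y + Ra) = (x + y) + Ra\<close> and
  \<open>r (x + Ra) = r x + Ra\<close>; see \<open>quot_add\<close> and \<open>quot_smult\<close> below.
\<close>

definition quot_mod :: "'a::ring_1 \<Rightarrow> ('a, 'a set) module" where
  "quot_mod a =
    \<lparr>carrier = {x +o left_ideal_of a | x. True}, mult = undefined, one = undefined,
     zero = left_ideal_of a,
     add = (\<lambda>X Y. X + Y),
     smult = (\<lambda>r X. (r *o X) + left_ideal_of a)\<rparr>"

definition direct_sum :: "('r, 'm) module list \<Rightarrow> ('r, nat \<Rightarrow> 'm) module" where
  "direct_sum Ms =
    \<lparr>carrier = (\<Pi>\<^sub>E i\<in>{..<length Ms}. carrier (Ms ! i)), mult = undefined, one = undefined,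
     zero = (\<lambda>i\<in>{..<length Ms}. \<zero>\<^bsub>Ms ! i\<^esub>),
     add = (\<lambda>u v. \<lambda>i\<in>{..<length Ms}. u i \<oplus>\<^bsub>Ms ! i\<^esub> v i),
     smult = (\<lambda>r u. \<lambda>i\<in>{..<length Ms}. r \<odot>\<^bsub>Ms ! i\<^esub> u i)\<rparr>"

definition similar :: "'a::ring_1 \<Rightarrow> 'a \<Rightarrow> bool" where
  "similar a b \<longleftrightarrow> a \<noteq> 0 \<and> b \<noteq> 0 \<and> lmod_iso (quot_mod a) (quot_mod b)"

definition similarity_class :: "'a::ring_1 \<Rightarrow> 'a set" where
  "similarity_class a = {b. similar a b}"

section \<open>Endomorphism rings and dimension\<close>

text \<open>
  Endomorphisms are written on the right of their arguments, so the product \<open>\<phi> \<psi>\<close> is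
  ``first \<open>\<phi>\<close>, then \<open>\<psi>\<close>''.
\<close>

definition lmod_End :: "('r, 'm) module \<Rightarrow> ('m \<Rightarrow> 'm) ring" where
  "lmod_End M =
    \<lparr>carrier = lmod_hom M M,
     mult = (\<lambda>\<phi> \<psi>. \<lambda>x\<in>carrier M. \<psi> (\<phi> x)),
     one = (\<lambda>x\<in>carrier M. x),
     zero = (\<lambda>x\<in>carrier M. \<zero>\<^bsub>M\<^esub>),
     add = (\<lambda>\<phi> \<psi>. \<lambda>x\<in>carrier M. \<phi> x \<oplus>\<^bsub>M\<^esub> \<psi> x)\<rparr>"

definition C_ring :: "'a::ring_1 \<Rightarrow> ('a set \<Rightarrow> 'a set) ring" where
  "C_ring p = lmod_End (quot_mod p)"

text \<open>Division rings in the sense of \<open>HOL-Algebra\<close>, not necessarily commutative.\<close>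

definition skew_field :: "'d ring \<Rightarrow> bool" where
  "skew_field D \<longleftrightarrow> ring D \<and> \<one>\<^bsub>D\<^esub> \<noteq> \<zero>\<^bsub>D\<^esub> \<and> Units D = carrier D - {\<zero>\<^bsub>D\<^esub>}"

text \<open>
  A right vector space \<open>V\<close> over \<open>D\<close> is stored in the same record type; there
  \<open>smult c v\<close> stands for \<open>v c\<close>.
\<close>

definition lin_indep :: "'d ring \<Rightarrow> ('d, 'm) module \<Rightarrow> 'm set \<Rightarrow> bool" where
  "lin_indep D V B \<longleftrightarrow>
    (\<forall>A c. finite A \<and> A \<subseteq> B \<and> c \<in> A \<rightarrow> carrier D \<and> (\<Oplus>\<^bsub>V\<^esub>v\<in>A. c v \<odot>\<^bsub>V\<^esub> v) = \<zero>\<^bsub>V\<^esub>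
       \<longrightarrow> (\<forall>v\<in>A. c v = \<zero>\<^bsub>D\<^esub>))"

definition lin_span :: "'d ring \<Rightarrow> ('d, 'm) module \<Rightarrow> 'm set \<Rightarrow> 'm set" where
  "lin_span D V B =
    {(\<Oplus>\<^bsub>V\<^esub>v\<in>A. c v \<odot>\<^bsub>V\<^esub> v) | A c. finite A \<and> A \<subseteq> B \<and> c \<in> A \<rightarrow> carrier D}"

definition lin_basis :: "'d ring \<Rightarrow> ('d, 'm) module \<Rightarrow> 'm set \<Rightarrow> bool" where
  "lin_basis D V B \<longleftrightarrow> B \<subseteq> carrier V \<and> lin_indep D V B \<and> lin_span D V B = carrier V"

definition ecard :: "'b set \<Rightarrow> enat" where
  "ecard A = (if finite A then enat (card A) else \<infinity>)"

definition vdim :: "'d ring \<Rightarrow> ('d, 'm) module \<Rightarrow> enat" where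
  "vdim D V = ecard (SOME B. lin_basis D V B)"

text \<open>
  \<open>\<lambda>\<^sub>f\<^sub>,\<^sub>p\<close> maps \<open>x + Rp\<close> to \<open>f x + Rp\<close>, i.e. it is the action of the scalar \<open>f\<close>.
\<close>

definition lambda_map :: "'a::ring_1 \<Rightarrow> 'a \<Rightarrow> 'a set \<Rightarrow> 'a set" where
  "lambda_map f p = (\<lambda>X\<in>carrier (quot_mod p). f \<odot>\<^bsub>quot_mod p\<^esub> X)"

text \<open>\<open>ker \<lambda>\<^sub>f\<^sub>,\<^sub>p\<close> as a right \<open>C(p)\<close>-space, on which \<open>\<phi>\<close> acts by evaluation.\<close>

definition ker_lambda :: "'a::ring_1 \<Rightarrow> 'a \<Rightarrow> ('a set \<Rightarrow> 'a set, 'a set) module" where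
  "ker_lambda f p =
    \<lparr>carrier = {X \<in> carrier (quot_mod p). lambda_map f p X = \<zero>\<^bsub>quot_mod p\<^esub>},
     mult = undefined, one = undefined,
     zero = \<zero>\<^bsub>quot_mod p\<^esub>,
     add = add (quot_mod p),
     smult = (\<lambda>\<phi> X. \<phi> X)\<rparr>"

section \<open>Factors and full reducibility\<close>

definition fully_reducible :: "'a::ring_1 \<Rightarrow> bool" where
  "fully_reducible f \<longleftrightarrow>
    f \<in> finite_length \<and>
    (\<exists>ps. set ps \<subseteq> atoms \<and> left_ideal_of f = (\<Inter>p\<in>set ps. left_ideal_of p))"

definition is_factor :: "'a::ring_1 \<Rightarrow> 'a \<Rightarrow> bool" where
  "is_factor g f \<longleftrightarrow> g \<notin> ring_units \<and> (\<exists>p q. f = p * g * q)"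

definition neighbouring :: "'a::ring_1 \<Rightarrow> 'a \<Rightarrow> 'a \<Rightarrow> bool" where
  "neighbouring f g h \<longleftrightarrow> is_factor g f \<and> is_factor h f \<and> (\<exists>p q. f = p * g * h * q)"

section \<open>\<open>F\<close>-dependence and rank\<close>

definition F_algebraic :: "'a::ring_1 set \<Rightarrow> bool" where
  "F_algebraic D \<longleftrightarrow>
    D \<subseteq> finite_length - ring_units \<and> (\<Inter>d\<in>D. left_ideal_of d) \<noteq> {0}"

text \<open>\<open>F_algebraic (insert d D)\<close> implies that \<open>D\<close> is \<open>F\<close>-algebraic and that \<open>d\<close> has finite length.\<close>

definition F_dependent :: "'a::ring_1 \<Rightarrow> 'a set \<Rightarrow> bool" where
  "F_dependent d D \<longleftrightarrow>
    F_algebraic (insert d D) \<and>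
    (\<exists>G. finite G \<and> G \<subseteq> D \<and> left_ideal_of d + (\<Inter>g\<in>G. left_ideal_of g) \<noteq> UNIV)"

definition F_independent :: "'a::ring_1 set \<Rightarrow> bool" where
  "F_independent D \<longleftrightarrow> F_algebraic D \<and> (\<forall>d\<in>D. \<not> F_dependent d (D - {d}))"

definition F_basis :: "'a::ring_1 set \<Rightarrow> 'a set \<Rightarrow> bool" where
  "F_basis B D \<longleftrightarrow> B \<subseteq> D \<and> F_independent B \<and> (\<forall>d\<in>D. F_dependent d B)"

definition rk :: "'a::ring_1 set \<Rightarrow> enat" where
  "rk D = ecard (SOME B. F_basis B D)"

definition V_atoms :: "'a::ring_1 \<Rightarrow> 'a set" where
  "V_atoms a = {p \<in> atoms. a \<in> left_ideal_of p}"

text \<open>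
  The list \<open>qs\<close> represents the similarity classes met by \<open>V(f)\<close>, each exactly once. Its
  entries are not required to lie in \<open>V(f)\<close> themselves.
\<close>

definition similarity_decomp :: "'a::ring_1 \<Rightarrow> 'a list \<Rightarrow> bool" where
  "similarity_decomp f qs \<longleftrightarrow>
    set qs \<subseteq> atoms \<and>
    (\<forall>i<length qs. \<forall>j<length qs. i \<noteq> j \<longrightarrow> \<not> similar (qs ! i) (qs ! j)) \<and>
    (\<forall>i<length qs. V_atoms f \<inter> similarity_class (qs ! i) \<noteq> {}) \<and>
    V_atoms f = (\<Union>i<length qs. V_atoms f \<inter> similarity_class (qs ! i))"

section \<open>The operations on cosets are the expected ones\<close>

lemma left_ideal_of_props:
  "0 \<in> left_ideal_of a"
  "x \<in> left_ideal_of a \<Longrightarrow> y \<in> left_ideal_of a \<Longrightarrow> x + y \<in> left_ideal_of a"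
  "x \<in> left_ideal_of a \<Longrightarrow> r * x \<in> left_ideal_of a"
proof -
  show "0 \<in> left_ideal_of a"
    unfolding left_ideal_of_def using mult_zero_left[of a] by (metis (mono_tags, lifting) mem_Collect_eq)
  show "x + y \<in> left_ideal_of a" if "x \<in> left_ideal_of a" "y \<in> left_ideal_of a"
    using that unfolding left_ideal_of_def by (auto simp: distrib_right[symmetric])
  show "r * x \<in> left_ideal_of a" if "x \<in> left_ideal_of a"
    using that unfolding left_ideal_of_def by (auto simp: mult.assoc[symmetric])
qed

lemma quot_add:
  "(x +o left_ideal_of a) \<oplus>\<^bsub>quot_mod a\<^esub> (y +o left_ideal_of a) = (x + y) +o left_ideal_of a"
proof -
  have "left_ideal_of a + left_ideal_of a = left_ideal_of a"
  proof
    show "left_ideal_of a + left_ideal_of a \<subseteq> left_ideal_of a"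
      by (auto simp: set_plus_def intro: left_ideal_of_props(2))
    show "left_ideal_of a \<subseteq> left_ideal_of a + left_ideal_of a"
      using set_plus_intro[OF left_ideal_of_props(1)] by fastforce
  qed
  then show ?thesis
    by (simp add: quot_mod_def set_plus_rearrange)
qed

lemma quot_smult:
  "r \<odot>\<^bsub>quot_mod a\<^esub> (x +o left_ideal_of a) = (r * x) +o left_ideal_of a"
proof -
  have "r *o (x +o left_ideal_of a) + left_ideal_of a = (r * x) +o left_ideal_of a"
  proof (intro equalityI subsetI)
    fix z assume "z \<in> r *o (x +o left_ideal_of a) + left_ideal_of a"
    then obtain u v where "u \<in> left_ideal_of a" "v \<in> left_ideal_of a" "z = r * (x + u) + v"
      by (auto simp: set_plus_def elt_set_plus_def elt_set_times_def)
    then show "z \<in> (r * x) +o left_ideal_of a"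
      using left_ideal_of_props(2,3)[of _ a]
      by (auto simp: elt_set_plus_def distrib_left add.assoc)
  next
    fix z assume "z \<in> (r * x) +o left_ideal_of a"
    then obtain v where "v \<in> left_ideal_of a" "z = r * (x + 0) + v"
      by (auto simp: elt_set_plus_def)
    then show "z \<in> r *o (x +o left_ideal_of a) + left_ideal_of a"
      using left_ideal_of_props(1)[of a]
      by (fastforce simp: set_plus_def elt_set_plus_def elt_set_times_def)
  qed
  then show ?thesis
    by (simp add: quot_mod_def)
qed

lemma lambda_map_coset:
  "lambda_map f p (x +o left_ideal_of p) = (f * x) +o left_ideal_of p"
proof -
  have "x +o left_ideal_of p \<in> carrier (quot_mod p)"
    by (auto simp: quot_mod_def)
  then show ?thesis
    by (simp add: lambda_map_def quot_smult)
qed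

end

theory Submission
  imports Defs
begin

text \<open>
  The principal left ideals between \<open>Rf\<close> and \<open>R\<close> form a modular lattice of finite length, in which
  similarity plays the role of perspectivity; lengths are therefore additive. Let \<open>Rm\<close> be the
  intersection of all \<open>Rp\<close> with \<open>p \<in> V(f)\<close>. Then \<open>\<ell>(m) = rk V(f)\<close>, because a set of atoms is
  \<open>F\<close>-independent iff its least common left multiple has as many atomic factors as the set has elements.
  Likewise \<open>dim ker \<lambda>\<^sub>f\<^sub>,\<^sub>q\<close> is the length of the generator of the annihilator of the kernel, since
  adjoining a linearly independent vector to a set multiplies the generator of its annihilator by one atom
  similar to \<open>q\<close>; the generators for non-similar \<open>q\<close> are coprime, so these dimensions add up to \<open>\<ell>(m)\<close>
  as well. Since \<open>f \<in> Rm\<close>, all of this reduces (ii), (iii) and (viii) to \<open>Rf = Rm\<close>, which is (i).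
  Full reducibility passes to left factors by intersecting with \<open>Ry \<supseteq> Rxy\<close>, and to right factors
  because these are similar to left factors.
\<close>

text \<open>The sum of two principal left ideals is guaranteed to be principal only if they meet
  nontrivially, and for an atom p the left ideal Rp need not be maximal, so R/Rp need not be simple.
  Arguments about simple modules are therefore replaced by statements on principal left ideals above
  a fixed nonzero element, which is why most lemmas carry a nonzero common left multiple. Schur's
  lemma and the annihilators of vectors both go through \<open>atom_colon\<close>, where that
  multiple is \<open>f * x\<close>. The class axiom speaks of right ideals and the theorem of left
  ones, so the symmetry of the condition has to be derived. Isomorphisms are handled as membership
  conditions (\<open>rmult_iso\<close>) and translated to modules by \<open>similar_iff\<close>.
  V(f) may be infinite, and \<open>rk\<close> and \<open>vdim\<close> choose arbitrary bases; both
  difficulties are met by bounding independent sets by the length of f.\<close>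

abbreviation (input) L :: "'a::ring_1 \<Rightarrow> 'a set" where
  "L \<equiv> left_ideal_of"

section \<open>Principal left ideals\<close>

lemma mem_L_iff: "x \<in> L a \<longleftrightarrow> (\<exists>r. x = r * a)"
  by (auto simp: left_ideal_of_def)

lemma L_multI [simp, intro]: "r * a \<in> L a"
  by (auto simp: mem_L_iff)

lemma L_self [simp]: "a \<in> L a"
  by (metis L_multI mult_1)

lemma L_one [simp]: "L 1 = UNIV"
  by (auto simp: mem_L_iff)

lemmas L_zero [simp] = left_ideal_of_props(1)
lemmas L_add = left_ideal_of_props(2)
lemmas L_mult_left = left_ideal_of_props(3)

lemma L_diff: "x \<in> L a \<Longrightarrow> y \<in> L a \<Longrightarrow> x - y \<in> L a"
  by (metis (no_types, lifting) left_diff_distrib mem_L_iff)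

lemma L_minus: "x \<in> L a \<Longrightarrow> - x \<in> L a"
  by (metis L_diff L_zero diff_0)

lemma L_add_cancel: "x \<in> L a \<Longrightarrow> x + y \<in> L a \<longleftrightarrow> y \<in> L a"
  by (metis L_add L_diff add_diff_cancel_left')

lemma L_minus_iff: "- x \<in> L a \<longleftrightarrow> x \<in> L a"
  by (metis L_minus minus_minus)

lemma L_diff_commute: "x - y \<in> L a \<longleftrightarrow> y - x \<in> L a"
  by (metis L_minus_iff minus_diff_eq)

lemma L_cong: "x - y \<in> L a \<Longrightarrow> x \<in> L a \<longleftrightarrow> y \<in> L a"
  by (metis L_add_cancel diff_add_cancel)

lemma L_trans: "x \<in> L a \<Longrightarrow> a \<in> L b \<Longrightarrow> x \<in> L b"
  by (metis L_mult_left mem_L_iff)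

lemma L_subset_iff: "L a \<subseteq> L b \<longleftrightarrow> a \<in> L b"
  using L_trans by (metis L_self subset_iff)

lemma L_eq_iff: "L a = L b \<longleftrightarrow> a \<in> L b \<and> b \<in> L a"
  using L_subset_iff by blast

lemma L_mult_cancel:
  fixes a :: "'a::ring_1_no_zero_divisors"
  shows "a \<noteq> 0 \<Longrightarrow> r * a \<in> L (b * a) \<longleftrightarrow> r \<in> L b"
  by (auto simp: mem_L_iff mult.assoc[symmetric])

text \<open>In a domain a left inverse is two-sided, so being a unit depends only on the left
  ideal.\<close>

lemma ring_units_iff:
  fixes u :: "'a::ring_1_no_zero_divisors"
  shows "u \<in> ring_units \<longleftrightarrow> 1 \<in> L u"
proof
  show "u \<in> ring_units \<Longrightarrow> 1 \<in> L u"
    by (auto simp: ring_units_def mem_L_iff)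
  assume "1 \<in> L u"
  then obtain v where v: "v * u = 1" by (auto simp: mem_L_iff)
  have "(u * v - 1) * u = 0" by (simp add: algebra_simps v)
  moreover have "u \<noteq> 0" using v by auto
  ultimately have "u * v = 1" by simp
  with v show "u \<in> ring_units" by (auto simp: ring_units_def)
qed

lemma ring_units_L: "u \<in> ring_units \<longleftrightarrow> L u = (UNIV :: 'a::ring_1_no_zero_divisors set)"
  using L_eq_iff[of u 1] by (simp add: ring_units_iff)

lemma zero_notin_ring_units [simp]: "(0::'a::ring_1_no_zero_divisors) \<notin> ring_units"
  by (auto simp: ring_units_def)

lemma one_in_ring_units [simp]: "1 \<in> ring_units"
  by (auto simp: ring_units_def)

lemma mult_in_ring_units_iff:
  fixes a b :: "'a::ring_1_no_zero_divisors"
  shows "a * b \<in> ring_units \<longleftrightarrow> a \<in> ring_units \<and> b \<in> ring_units"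
proof
  assume "a * b \<in> ring_units"
  then obtain v where v: "a * b * v = 1" "v * (a * b) = 1" by (auto simp: ring_units_def)
  have "b \<in> ring_units"
    using v(2) by (metis ring_units_iff mem_L_iff mult.assoc)
  moreover have "a \<in> ring_units"
  proof -
    \<comment> \<open>\<open>b * v\<close> is a right inverse of \<open>a\<close>; the domain
      property makes it a left inverse as well.\<close>
    have "a * ((b * v) * a - 1) = 0" using v(1) by (simp add: algebra_simps flip: mult.assoc)
    moreover have "a \<noteq> 0" using v(1) by auto
    ultimately show ?thesis by (metis ring_units_iff L_multI eq_iff_diff_eq_0 mult_eq_0_iff)
  qed
  ultimately show "a \<in> ring_units \<and> b \<in> ring_units" by blast
next
  assume "a \<in> ring_units \<and> b \<in> ring_units"
  then obtain v w where "v * a = 1" "w * b = 1" by (auto simp: ring_units_def)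
  then have "(w * v) * (a * b) = 1" by (metis mult.assoc mult_1)
  then show "a * b \<in> ring_units" by (metis ring_units_iff L_multI)
qed

lemma L_unit_mult:
  fixes u :: "'a::ring_1_no_zero_divisors"
  shows "u \<in> ring_units \<Longrightarrow> L (u * a) = L a"
  by (auto simp: L_eq_iff ring_units_def) (metis L_multI mult.assoc mult_1)

section \<open>Left-right symmetry of the 2-fir condition\<close>

text \<open>The class axiom is applied to the left cofactors \<open>x\<close>, \<open>y\<close> of a
  common left multiple: right ideals of the cofactors control left ideals of the elements.
  Cancelling \<open>d\<close> leaves a comaximal pair.\<close>

lemma right_gcd:
  fixes x y :: "'a::two_fir"
  assumes "x * a = y * b" "x * a \<noteq> 0"
  obtains d x' y' u v where "x = d * x'" "y = d * y'" "x' * u + y' * v = 1" "d \<noteq> 0"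
proof -
  have "x * a \<in> range ((*) x) \<inter> range ((*) y)"
    using rangeI[of "(*) x" a] rangeI[of "(*) y" b] assms(1) by simp
  then have "range ((*) x) \<inter> range ((*) y) \<noteq> {0}" using assms by blast
  from two_fir[OF this] obtain d where d: "{x * u + y * v | u v. True} = range ((*) d)" by blast
  have "x * 1 + y * 0 \<in> range ((*) d)" "x * 0 + y * 1 \<in> range ((*) d)"
    using d by blast+
  then obtain x' y' where "x = d * x'" "y = d * y'" by auto
  moreover have "d * 1 \<in> {x * u + y * v | u v. True}"
    unfolding d by blast
  then obtain u v where "x * u + y * v = d" by auto
  ultimately have *: "x = d * x'" "y = d * y'" "x * u + y * v = d" .
  have "d \<noteq> 0" using * assms by auto
  moreover have "d * (x' * u + y' * v - 1) = 0"
    using * by (simp add: algebra_simps flip: mult.assoc)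
  ultimately have "x' * u + y' * v = 1" by simp
  then show thesis using * \<open>d \<noteq> 0\<close> that by blast
qed

text \<open>The row \<open>(x', y')\<close> splits \<open>R\<^sup>2 \<rightarrow> R\<close>; its kernel is generated by \<open>(a\<^sub>0, -b\<^sub>0)\<close>, and the
  complementary projection exhibits \<open>1\<close> as a left combination of \<open>a\<^sub>0\<close> and \<open>b\<^sub>0\<close>.\<close>

lemma left_gcd_lcm:
  fixes a b f :: "'a::two_fir"
  assumes "f \<in> L a" "f \<in> L b" "f \<noteq> 0"
  obtains d m u v where "d = u * a + v * b" "a \<in> L d" "b \<in> L d" "L m = L a \<inter> L b"
proof -
  obtain x y where xy: "f = x * a" "f = y * b" using assms by (metis mem_L_iff)
  obtain e x' y' u v where e: "x = e * x'" "y = e * y'" "x' * u + y' * v = 1" "e \<noteq> 0"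
    using right_gcd[of x a y b] xy assms(3) by metis
  have eq: "x' * a = y' * b" using xy e by (simp add: mult.assoc)
  have nz: "x' * a \<noteq> 0" "x' \<noteq> 0" "y' \<noteq> 0" "a \<noteq> 0" "b \<noteq> 0"
    using xy e assms(3) by (auto simp: mult.assoc)
  have "x' * a \<in> range ((*) x') \<inter> range ((*) y')"
    using rangeI[of "(*) x'" a] rangeI[of "(*) y'" b] eq by simp
  then have "range ((*) x') \<inter> range ((*) y') \<noteq> {0}" using nz by blast
  from two_fir[OF this] obtain m0 where m0: "range ((*) x') \<inter> range ((*) y') = range ((*) m0)"
    by blast
  have ker: "\<exists>t. p = m0 * t" if "p = x' * q" "p = y' * r" for p q r
    using m0 that by blast
  have "m0 * 1 \<in> range ((*) x') \<inter> range ((*) y')"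
    using m0 by blast
  then obtain a0 b0 where ab0: "m0 = x' * a0" "m0 = y' * b0" by (metis IntE imageE mult_1_right)
  \<comment> \<open>Up to the sign of the second entry, the solutions (q, r) form the kernel of the
    row, so this says that the kernel is generated by a single column.\<close>
  have split: "\<exists>t. q = a0 * t \<and> r = b0 * t" if "x' * q = y' * r" for q r
  proof -
    obtain t where "x' * q = m0 * t" using ker[OF refl \<open>x' * q = y' * r\<close>] by blast
    then have "x' * q = x' * (a0 * t)" "y' * r = y' * (b0 * t)"
      using ab0 that by (simp_all flip: mult.assoc)
    then show ?thesis using nz by auto
  qed
  obtain t where t: "a = a0 * t" "b = b0 * t" using split eq by blast
  \<comment> \<open>The idempotent 1 - (u, v)^T (x', y') maps onto the kernel; its two columns give
    \<open>p\<close> and \<open>q\<close>.\<close>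
  have "x' * (1 - u * x') = y' * (v * x')"
    using arg_cong[OF e(3), of "\<lambda>z. z * x'"] by (simp add: algebra_simps)
  from split[OF this] obtain p where p: "1 - u * x' = a0 * p" "v * x' = b0 * p" by blast
  have "x' * (- (u * y')) = y' * (v * y' - 1)"
    using arg_cong[OF e(3), of "\<lambda>z. z * y'"] by (simp add: algebra_simps)
  from split[OF this] obtain q where q: "- (u * y') = a0 * q" "v * y' - 1 = b0 * q" by blast
  \<comment> \<open>The idempotent fixes the generator of the kernel; cancelling \<open>a0\<close>
    then yields the left Bezout relation.\<close>
  have "a0 * (p * a0 - q * b0) = (1 - u * x') * a0 + u * y' * b0"
    by (simp add: p(1) q(1)[symmetric] right_diff_distrib flip: mult.assoc)
  also have "\<dots> = a0 - u * (x' * a0) + u * (y' * b0)" by (simp add: algebra_simps)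
  finally have "a0 * (p * a0 - q * b0) = a0" using ab0 by simp
  moreover have "a0 \<noteq> 0" using t nz by auto
  ultimately have one: "p * a0 - q * b0 = 1" by (metis mult_cancel_left mult_1_right)
  have "t = p * a + (- q) * b"
    using arg_cong[OF one, of "\<lambda>z. z * t"] t by (simp add: algebra_simps)
  moreover have "a \<in> L t" "b \<in> L t" using t by auto
  moreover have "L (x' * a) = L a \<inter> L b"
  proof (intro equalityI subsetI)
    fix z assume "z \<in> L (x' * a)"
    then show "z \<in> L a \<inter> L b" using eq L_trans by (metis IntI L_multI)
  next
    fix z assume "z \<in> L a \<inter> L b"
    then obtain r s where rs: "z = r * a" "z = s * b" by (metis IntE mem_L_iff)
    have "t \<noteq> 0" using t nz by auto
    then have rs0: "r * a0 = s * b0" using rs t by (metis mult.assoc mult_right_cancel)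
    \<comment> \<open>Multiplying \<open>r * a0 = s * b0\<close> on the right by \<open>p\<close>
      exhibits \<open>r\<close> as a left multiple of \<open>x'\<close>.\<close>
    have "r - r * u * x' = s * v * x'"
    proof -
      have "r * (1 - u * x') = r * a0 * p" by (simp add: p mult.assoc)
      also have "\<dots> = s * (v * x')" by (simp add: rs0 p mult.assoc)
      finally show ?thesis by (simp add: algebra_simps)
    qed
    then have "r = (r * u + s * v) * x'" by (simp add: algebra_simps)
    then show "z \<in> L (x' * a)" using rs by (metis L_multI mult.assoc)
  qed
  ultimately show thesis using that by blast
qed

section \<open>Elementwise similarity\<close>

text \<open>Right multiplication by \<open>t\<close> induces an isomorphism \<open>R/Ra \<rightarrow> R/Rb\<close>.\<close>

definition rmult_iso :: "'a::ring_1 \<Rightarrow> 'a \<Rightarrow> 'a \<Rightarrow> bool" where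
  "rmult_iso a b t \<longleftrightarrow> (\<forall>r. r * t \<in> L b \<longleftrightarrow> r \<in> L a) \<and> (\<exists>u v. u * t + v * b = 1)"

lemma rmult_iso_D: "rmult_iso a b t \<Longrightarrow> r * t \<in> L b \<longleftrightarrow> r \<in> L a"
  by (auto simp: rmult_iso_def)

lemma rmult_iso_L_cong:
  assumes "L a = L b"
  shows "rmult_iso a b 1"
  unfolding rmult_iso_def
proof (intro conjI allI exI)
  show "r * 1 \<in> L b \<longleftrightarrow> r \<in> L a" for r using assms by simp
  show "1 * 1 + 0 * b = 1" by simp
qed

lemma rmult_iso_trans:
  assumes "rmult_iso a b s" "rmult_iso b c t"
  shows "rmult_iso a c (s * t)"
proof -
  obtain u v u' v' where *: "u * s + v * b = 1" "u' * t + v' * c = 1"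
    using assms by (auto simp: rmult_iso_def)
  have "b * t \<in> L c" using assms(2) by (simp add: rmult_iso_def)
  then obtain w where w: "b * t = w * c" by (auto simp: mem_L_iff)
  have "u' * (u * s + v * b) * t + v' * c = 1" using * by simp
  then have "(u' * u) * (s * t) + (u' * v * w + v') * c = 1"
    by (simp add: algebra_simps w)
  moreover have "r * (s * t) \<in> L c \<longleftrightarrow> r \<in> L a" for r
    using assms by (simp add: rmult_iso_def flip: mult.assoc)
  ultimately show ?thesis unfolding rmult_iso_def by blast
qed

text \<open>The Bezout coefficient of \<open>t\<close> induces the inverse map; the two congruences
  say that both composites are the identity.\<close>

lemma rmult_iso_inverse:
  assumes "rmult_iso a b t"
  obtains s where "rmult_iso b a s" "s * t - 1 \<in> L b" "t * s - 1 \<in> L a"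
proof -
  obtain s v where *: "s * t + v * b = 1"
    using assms by (auto simp: rmult_iso_def)
  have st: "s * t - 1 = (- v) * b" using * by (simp add: algebra_simps eq_diff_eq)
  have "r * s \<in> L a \<longleftrightarrow> r \<in> L b" for r
  proof -
    have "r * s * t - r = - (r * v) * b"
      using arg_cong[OF st, of "\<lambda>z. r * z"] by (simp add: algebra_simps)
    then have "r * s * t - r \<in> L b" by (metis L_multI)
    then show ?thesis using L_cong rmult_iso_D[OF assms, of "r * s"] by blast
  qed
  moreover have "(t * s - 1) * t = - (t * v) * b"
    using arg_cong[OF st, of "\<lambda>z. t * z"] by (simp add: algebra_simps)
  then have ts: "t * s - 1 \<in> L a" by (metis L_multI rmult_iso_D[OF assms])
  moreover from ts obtain w where "t * s - 1 = w * a" by (auto simp: mem_L_iff)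
  then have "t * s + (- w) * a = 1" by (simp add: algebra_simps)
  ultimately have "rmult_iso b a s" unfolding rmult_iso_def by blast
  moreover have "s * t - 1 \<in> L b" unfolding st by (rule L_multI)
  ultimately show thesis using ts that by blast
qed

lemma rmult_iso_unit:
  fixes a b :: "'a::ring_1_no_zero_divisors"
  assumes "rmult_iso a b t"
  shows "a \<in> ring_units \<longleftrightarrow> b \<in> ring_units"
proof -
  have "1 \<in> L a \<Longrightarrow> 1 \<in> L b"
  proof -
    assume "1 \<in> L a"
    then have "t \<in> L b" using rmult_iso_D[OF assms, of 1] by simp
    moreover obtain u v where "u * t + v * b = 1" using assms by (auto simp: rmult_iso_def)
    ultimately show "1 \<in> L b" by (metis L_add L_mult_left L_multI)
  qed
  moreover have "1 \<in> L b \<Longrightarrow> 1 \<in> L a"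
    using rmult_iso_D[OF assms, of 1] L_mult_left[of 1 b t] by simp
  ultimately show ?thesis by (auto simp: ring_units_iff)
qed

lemma rmult_iso_nonzero:
  fixes a b :: "'a::ring_1_no_zero_divisors"
  assumes "rmult_iso a b t" "a \<noteq> 0"
  shows "b \<noteq> 0"
proof
  assume "b = 0"
  moreover have "a * t \<in> L b" using rmult_iso_D[OF assms(1)] by simp
  ultimately have "t = 0" using assms(2) by (auto simp: mem_L_iff)
  moreover obtain u v where "u * t + v * b = 1" using assms by (auto simp: rmult_iso_def)
  ultimately show False using \<open>b = 0\<close> by simp
qed

text \<open>A factorization a = c d corresponds to the submodule Rd/Ra of R/Ra, which is isomorphic
  to R/Rc and has quotient R/Rd. Its image in R/Rb is generated by the coset of
  \<open>d * t\<close>, hence equals Rd'/Rb where \<open>d'\<close> generates the sum of the left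
  ideals of \<open>d * t\<close> and \<open>b\<close>.\<close>

lemma rmult_iso_factor:
  fixes a b c d t :: "'a::two_fir"
  assumes iso: "rmult_iso a b t" and "a \<noteq> 0" and a: "a = c * d"
  obtains c' d' e where "b = c' * d'" "rmult_iso d d' t" "rmult_iso c c' e"
proof -
  have "b \<noteq> 0" using rmult_iso_nonzero assms by blast
  have abt: "c * (d * t) \<in> L b" using rmult_iso_D[OF iso, of a] a by (simp add: mult.assoc)
  \<comment> \<open>\<open>left_gcd_lcm\<close> needs a nonzero common multiple, here
    \<open>c * (d * t)\<close>; if it vanishes, \<open>b\<close> itself is the gcd.\<close>
  obtain d' x y where d': "d' = x * (d * t) + y * b" "d * t \<in> L d'" "b \<in> L d'"
  proof (cases "d * t = 0")
    case True
    show thesis by (rule that[of b 0 1]) (simp_all only: True L_zero L_self mult_1 mult_zero_left add_0)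
  next
    case False
    then show thesis
      using left_gcd_lcm[of "c * (d * t)" "d * t" b] abt that assms(2) a
      by (metis L_multI mult_eq_0_iff)
  qed
  obtain c' e where ce: "b = c' * d'" "d * t = e * d'" using d' by (metis mem_L_iff)
  have "d' \<noteq> 0" using ce \<open>b \<noteq> 0\<close> by auto
  obtain u v where uv: "u * t + v * b = 1" using iso by (auto simp: rmult_iso_def)
  have "rmult_iso d d' t"
    unfolding rmult_iso_def
  proof (intro conjI allI exI)
    show "u * t + (v * c') * d' = 1" using uv ce by (simp add: mult.assoc)
    fix r
    show "r * t \<in> L d' \<longleftrightarrow> r \<in> L d"
    proof
      assume "r * t \<in> L d'"
      then obtain z where "r * t = z * (x * (d * t) + y * b)" using d' by (auto simp: mem_L_iff)
      then have "(r - z * x * d) * t = (z * y) * b" by (simp add: algebra_simps)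
      then have "r - z * x * d \<in> L a" using rmult_iso_D[OF iso] by (metis L_multI)
      then have "r - z * x * d \<in> L d" using a L_trans by blast
      then show "r \<in> L d" using L_cong by blast
    next
      assume "r \<in> L d"
      then show "r * t \<in> L d'" using d'(2) by (metis L_mult_left mem_L_iff mult.assoc)
    qed
  qed
  moreover have "rmult_iso c c' e"
    unfolding rmult_iso_def
  proof (intro conjI allI exI)
    have "(x * e + y * c') * d' = 1 * d'" using d'(1) ce by (simp add: algebra_simps)
    then show "x * e + y * c' = 1" using \<open>d' \<noteq> 0\<close> by (metis mult_right_cancel)
    fix r
    have "r * e \<in> L c' \<longleftrightarrow> r * e * d' \<in> L b" using \<open>d' \<noteq> 0\<close> ce(1) L_mult_cancel by blast
    also have "r * e * d' = (r * d) * t" using ce(2) by (simp add: mult.assoc)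
    also have "\<dots> \<in> L b \<longleftrightarrow> r \<in> L c"
      using rmult_iso_D[OF iso, of "r * d"] a assms(2) L_mult_cancel[of d r c] by simp
    finally show "r * e \<in> L c' \<longleftrightarrow> r \<in> L c" .
  qed
  ultimately show thesis using that ce by blast
qed

section \<open>Atoms and comaximality\<close>

lemma atoms_nonzero: "p \<in> atoms \<Longrightarrow> p \<noteq> 0"
  and atoms_nonunit: "p \<in> atoms \<Longrightarrow> p \<notin> ring_units"
  by (auto simp: atoms_def)

lemma atoms_iff:
  "p \<in> atoms \<longleftrightarrow> p \<noteq> 0 \<and> p \<notin> ring_units \<and> (\<forall>b c. p = b * c \<longrightarrow> b \<in> ring_units \<or> c \<in> ring_units)"
  by (auto simp: atoms_def)

lemma rmult_iso_atom:
  fixes a b :: "'a::two_fir"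
  assumes "rmult_iso a b t" "a \<in> atoms"
  shows "b \<in> atoms"
proof -
  have a: "a \<noteq> 0" "a \<notin> ring_units" using assms atoms_iff by auto
  have b: "b \<noteq> 0" "b \<notin> ring_units" using a assms rmult_iso_nonzero rmult_iso_unit by blast+
  obtain s where s: "rmult_iso b a s" using rmult_iso_inverse assms by metis
  have "c \<in> ring_units \<or> d \<in> ring_units" if cd: "b = c * d" for c d
  proof -
    obtain c' d' e where "a = c' * d'" "rmult_iso d d' s" "rmult_iso c c' e"
      using rmult_iso_factor[OF s b(1) cd] by metis
    then show ?thesis using assms(2) rmult_iso_unit unfolding atoms_iff by metis
  qed
  then show ?thesis using b by (auto simp: atoms_iff)
qed

text \<open>The cofactor of \<open>q\<close> in the atom \<open>p\<close> must be a unit. This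
  serves as maximality of \<open>L p\<close> among the proper principal left ideals.\<close>

lemma atom_L_subset:
  fixes p q :: "'a::ring_1_no_zero_divisors"
  assumes "p \<in> atoms" "p \<in> L q" "q \<notin> ring_units"
  shows "L p = L q"
proof -
  obtain u where "p = u * q" using assms by (auto simp: mem_L_iff)
  then show ?thesis using assms L_unit_mult[of u q] by (auto simp: atoms_iff)
qed

text \<open>The common left multiple \<open>f\<close> makes Rh + Rp principal, and the generator is
  a unit because it cannot generate Rp.\<close>

lemma coprime_atom:
  fixes f p h :: "'a::two_fir"
  assumes "f \<noteq> 0" "f \<in> L h" "f \<in> L p" "p \<in> atoms" "h \<notin> L p"
  shows "\<exists>u v. u * h + v * p = 1"
proof -
  obtain d u v where d: "d = u * h + v * p" "h \<in> L d" "p \<in> L d"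
    using left_gcd_lcm[OF assms(2,3,1)] by metis
  have "d \<in> ring_units"
    using atom_L_subset[OF assms(4) d(3)] d(2) assms(5) by blast
  then obtain w where "w * d = 1" by (auto simp: ring_units_def)
  then have "(w * u) * h + (w * v) * p = 1" using d(1) by (simp add: algebra_simps)
  then show ?thesis by blast
qed

text \<open>Second isomorphism theorem: since Rh + Rg = R, right multiplication by \<open>h\<close>
  induces R/Rg' \<cong> Rh/(Rh \<inter> Rg) \<cong> R/Rg, and symmetrically with
  \<open>g\<close>.\<close>

lemma coprime_lcm:
  fixes f g h :: "'a::two_fir"
  assumes "f \<noteq> 0" "f \<in> L h" "f \<in> L g" and uv: "u * h + v * g = 1"
  obtains g' h' where "g' * h = h' * g" "L (g' * h) = L h \<inter> L g" "rmult_iso g' g h"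
    "rmult_iso h' h g" "g' * h \<noteq> 0"
proof -
  obtain m where m: "L m = L h \<inter> L g" using left_gcd_lcm[OF assms(2,3,1)] by metis
  then have "m \<in> L h \<inter> L g" using L_self by blast
  then obtain g' h' where gh: "m = g' * h" "m = h' * g" by (metis IntE mem_L_iff)
  have nz: "h \<noteq> 0" "g \<noteq> 0" using assms by (auto simp: mem_L_iff)
  have "f \<in> L m" using m assms by blast
  then have "m \<noteq> 0" using assms(1) by (auto simp: mem_L_iff)
  have "r * h \<in> L g \<longleftrightarrow> r \<in> L g'" for r
    using L_mult_cancel[of h r g'] nz m gh(1) by auto
  then have "rmult_iso g' g h" using uv by (auto simp: rmult_iso_def)
  moreover have "r * g \<in> L h \<longleftrightarrow> r \<in> L h'" for r
    using L_mult_cancel[of g r h'] nz m gh(2) by auto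
  then have "rmult_iso h' h g" using uv by (auto simp: rmult_iso_def) (metis add.commute)
  ultimately show thesis using that gh m \<open>m \<noteq> 0\<close> by metis
qed

text \<open>The \<open>r\<close> with \<open>r * x \<in> L p\<close> form the annihilator of x + Rp.
  As \<open>f\<close> belongs to it, \<open>x\<close> and \<open>p\<close> have the nonzero common
  left multiple \<open>f * x\<close>, and the annihilator is generated by an atom similar to
  \<open>p\<close>.\<close>

lemma atom_colon:
  fixes f p x :: "'a::two_fir"
  assumes "f \<noteq> 0" "f * x \<in> L p" "p \<in> atoms" "x \<notin> L p"
  obtains p' where "p' \<in> atoms" "rmult_iso p' p x"
proof -
  have "x \<noteq> 0" using assms(4) by auto
  then have nz: "f * x \<noteq> 0" using assms(1) by simp
  obtain u v where uv: "u * x + v * p = 1"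
    using coprime_atom[OF nz _ assms(2,3,4)] by auto
  obtain p' where "rmult_iso p' p x"
    using coprime_lcm[OF nz _ assms(2) uv] by (metis L_multI)
  then show thesis using that rmult_iso_inverse rmult_iso_atom assms(3) by metis
qed

section \<open>Unique factorization lengths\<close>

text \<open>A relation, so that additivity and uniqueness can be proved before the infimum in
  \<open>atom_length\<close> is evaluated. Atoms are split off on the right because
  \<open>L p\<close> detects right factors; a unit may remain on the left.\<close>

fun natoms :: "nat \<Rightarrow> 'a::ring_1 \<Rightarrow> bool" where
  "natoms 0 a \<longleftrightarrow> a \<in> ring_units"
| "natoms (Suc n) a \<longleftrightarrow> (\<exists>g p. natoms n g \<and> p \<in> atoms \<and> a = g * p)"

lemma natoms_nonzero:
  fixes a :: "'a::ring_1_no_zero_divisors"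
  shows "natoms n a \<Longrightarrow> a \<noteq> 0"
  by (induction n arbitrary: a) (auto simp: atoms_iff)

lemma natoms_Suc_nonunit:
  fixes a :: "'a::ring_1_no_zero_divisors"
  shows "natoms (Suc n) a \<Longrightarrow> a \<notin> ring_units"
  by (auto simp: atoms_iff mult_in_ring_units_iff)

lemma unit_mult_atom:
  fixes p :: "'a::ring_1_no_zero_divisors"
  assumes "u \<in> ring_units" "p \<in> atoms"
  shows "u * p \<in> atoms"
proof -
  obtain v where v: "v * u = 1" "u * v = 1" using assms by (auto simp: ring_units_def)
  then have "u \<noteq> 0" by auto
  have "b \<in> ring_units \<or> c \<in> ring_units" if "u * p = b * c" for b c
  proof -
    have "p = (v * b) * c" using that v by (metis mult.assoc mult_1)
    then show ?thesis using assms mult_in_ring_units_iff atoms_iff by metis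
  qed
  then show ?thesis
    using assms \<open>u \<noteq> 0\<close> by (auto simp: atoms_iff mult_in_ring_units_iff)
qed

lemma natoms_one_iff:
  fixes p :: "'a::ring_1_no_zero_divisors"
  shows "natoms (Suc 0) p \<longleftrightarrow> p \<in> atoms"
proof
  show "natoms (Suc 0) p \<Longrightarrow> p \<in> atoms" using unit_mult_atom by auto
  show "p \<in> atoms \<Longrightarrow> natoms (Suc 0) p"
    by (simp, rule exI[of _ 1]) simp
qed

lemma natoms_mult:
  fixes a b :: "'a::ring_1_no_zero_divisors"
  shows "natoms k a \<Longrightarrow> natoms l b \<Longrightarrow> natoms (k + l) (a * b)"
proof (induction l arbitrary: b)
  case 0
  then show ?case
  proof (cases k)
    case (Suc k')
    with 0 obtain g p where gp: "natoms k' g" "p \<in> atoms" "a = g * p" by auto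
    \<comment> \<open>A unit on the right is absorbed by the last atom.\<close>
    have "p * b \<in> atoms"
    proof -
      obtain v where v: "v * b = 1" "b * v = 1" using 0 by (auto simp: ring_units_def)
      have "c \<in> ring_units \<or> d \<in> ring_units" if "p * b = c * d" for c d
      proof -
        have "p = c * (d * v)" using that v by (metis mult.assoc mult_1_right)
        then show ?thesis using gp(2) mult_in_ring_units_iff atoms_iff by metis
      qed
      then show ?thesis using gp(2) 0 v by (auto simp: atoms_iff mult_in_ring_units_iff)
    qed
    then show ?thesis using gp Suc by (auto simp: mult.assoc)
  qed (simp add: mult_in_ring_units_iff)
next
  case (Suc l)
  then show ?case by (auto simp: mult.assoc[symmetric]) blast
qed

lemma rmult_iso_natoms:
  fixes a b :: "'a::two_fir"
  shows "rmult_iso a b t \<Longrightarrow> natoms n a \<Longrightarrow> natoms n b"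
proof (induction n arbitrary: a b t)
  case 0
  then show ?case using rmult_iso_unit[OF 0(1)] by simp
next
  case (Suc n)
  from Suc.prems(2) obtain g p where gp: "natoms n g" "p \<in> atoms" "a = g * p" by auto
  obtain g' p' e where "b = g' * p'" "rmult_iso p p' t" "rmult_iso g g' e"
    using rmult_iso_factor[OF Suc.prems(1) natoms_nonzero[OF Suc.prems(2)] gp(3)] by metis
  then show ?case using Suc.IH gp rmult_iso_atom by auto blast
qed

lemma natoms_L_cong:
  fixes a b :: "'a::two_fir"
  shows "natoms n a \<Longrightarrow> L a = L b \<Longrightarrow> natoms n b"
  using rmult_iso_natoms rmult_iso_L_cong by blast

text \<open>Let p be the last atom in g h = e p. If p is a right factor of h, it cancels. Otherwise
  h and p are comaximal with least common left multiple p' h = h' p, and cancelling gives g = z p'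
  and e = z h': the atom moves into g as p', while h' has the length of h.\<close>

lemma natoms_factor:
  fixes g h :: "'a::two_fir"
  shows "natoms n (g * h) \<Longrightarrow> \<exists>k l. n = k + l \<and> natoms k g \<and> natoms l h"
proof (induction n arbitrary: g h)
  case 0
  then show ?case using mult_in_ring_units_iff by auto
next
  case (Suc n)
  then obtain e p where ep: "natoms n e" "p \<in> atoms" "g * h = e * p" by auto
  have nz: "g * h \<noteq> 0" using natoms_nonzero Suc.prems by blast
  show ?case
  proof (cases "h \<in> L p")
    case True
    then obtain h' where h: "h = h' * p" by (auto simp: mem_L_iff)
    then have "(g * h' - e) * p = 0" using ep(3) by (simp add: algebra_simps)
    then have "e = g * h'" using atoms_nonzero[OF ep(2)] by simp
    then obtain k l where "n = k + l" "natoms k g" "natoms l h'" using Suc.IH ep by blast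
    then show ?thesis using ep h by (intro exI[of _ k] exI[of _ "Suc l"]) auto
  next
    case False
    have mem: "g * h \<in> L h" "g * h \<in> L p" using ep(3) L_multI by metis+
    obtain u v where "u * h + v * p = 1" using coprime_atom nz mem ep(2) False by metis
    then obtain p' h' where ph: "p' * h = h' * p" "L (p' * h) = L h \<inter> L p" "rmult_iso p' p h"
      "rmult_iso h' h p"
      using coprime_lcm[OF nz mem] by metis
    have "g * h \<in> L (p' * h)" using mem ph by auto
    then obtain z where z: "g * h = z * (p' * h)" by (auto simp: mem_L_iff)
    have "(g - z * p') * h = 0" "(e - z * h') * p = 0"
      using z ph(1) ep(3) by (simp_all add: left_diff_distrib mult.assoc)
    then have ge: "g = z * p'" "e = z * h'" using nz atoms_nonzero[OF ep(2)] by auto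
    then obtain k l where kl: "n = k + l" "natoms k z" "natoms l h'" using Suc.IH ep by blast
    have "p' \<in> atoms" using ph(3) rmult_iso_inverse rmult_iso_atom ep(2) by metis
    then have "natoms (Suc k) g" using kl ge by auto
    moreover have "natoms l h" using kl(3) ph(4) rmult_iso_natoms by blast
    ultimately show ?thesis using kl(1) by (intro exI[of _ "Suc k"] exI[of _ l]) auto
  qed
qed

text \<open>\<open>natoms_factor\<close> distributes the second count over a = g p; it remains to
  see that an atom has no length other than 1.\<close>

lemma natoms_unique:
  fixes a :: "'a::two_fir"
  shows "natoms n a \<Longrightarrow> natoms m a \<Longrightarrow> n = m"
proof (induction n arbitrary: m a)
  case 0
  then show ?case using natoms_Suc_nonunit by (cases m) auto
next
  case (Suc n)
  then obtain g p where gp: "natoms n g" "p \<in> atoms" "a = g * p" by auto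
  obtain k l where kl: "m = k + l" "natoms k g" "natoms l p"
    using natoms_factor Suc.prems gp(3) by metis
  have "l = 1"
  proof (cases l)
    case (Suc l')
    then obtain g' p' where gp': "natoms l' g'" "p' \<in> atoms" "p = g' * p'" using kl(3) by auto
    then have "g' \<in> ring_units" using gp(2) by (auto simp: atoms_iff)
    then show ?thesis using gp' Suc natoms_Suc_nonunit by (cases l') auto
  qed (use kl gp atoms_iff in auto)
  then show ?case using Suc.IH gp kl by auto
qed

lemma natoms_prod_list:
  fixes ps :: "'a::ring_1_no_zero_divisors list"
  shows "set ps \<subseteq> atoms \<Longrightarrow> natoms (length ps) (prod_list ps)"
proof (induction ps)
  case (Cons p ps)
  then show ?case using natoms_mult[of "Suc 0" p "length ps" "prod_list ps"] natoms_one_iff[of p]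
    by simp
qed simp

text \<open>The leading unit is absorbed into the first atom. At length 0 there is no atom to absorb
  it; the clause for units in \<open>atom_length\<close> covers that case.\<close>

lemma natoms_Suc_obtain_list:
  fixes a :: "'a::ring_1_no_zero_divisors"
  shows "natoms (Suc n) a \<Longrightarrow> \<exists>ps. set ps \<subseteq> atoms \<and> prod_list ps = a \<and> length ps = Suc n"
proof (induction n arbitrary: a)
  case 0
  then show ?case by (intro exI[of _ "[a]"]) (simp add: natoms_one_iff del: natoms.simps)
next
  case (Suc n)
  then obtain g p where gp: "natoms (Suc n) g" "p \<in> atoms" "a = g * p"
    using natoms.simps(2)[of "Suc n" a] by blast
  with Suc.IH obtain ps where "set ps \<subseteq> atoms" "prod_list ps = g" "length ps = Suc n" by blast
  with gp show ?case by (intro exI[of _ "ps @ [p]"]) auto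
qed

lemma atom_length_natoms:
  fixes a :: "'a::two_fir"
  assumes "natoms n a"
  shows "atom_length a = enat n"
proof (cases n)
  case 0
  then show ?thesis using assms by (simp add: atom_length_def zero_enat_def)
next
  case (Suc m)
  then have nu: "a \<notin> ring_units" using assms natoms_Suc_nonunit by blast
  have "{enat (length ps) | ps. set ps \<subseteq> atoms \<and> prod_list ps = a} = {enat n}"
  proof (intro equalityI subsetI)
    fix k assume "k \<in> {enat (length ps) | ps. set ps \<subseteq> atoms \<and> prod_list ps = a}"
    then show "k \<in> {enat n}" using assms natoms_unique natoms_prod_list by blast
  next
    fix k assume "k \<in> {enat n}"
    then show "k \<in> {enat (length ps) | ps. set ps \<subseteq> atoms \<and> prod_list ps = a}"
      using natoms_Suc_obtain_list[of m a] assms Suc by (metis (mono_tags, lifting) CollectI singletonD)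
  qed
  then show ?thesis using nu by (simp add: atom_length_def)
qed

lemma finite_length_iff:
  fixes a :: "'a::two_fir"
  shows "a \<in> finite_length \<longleftrightarrow> (\<exists>n. natoms n a)"
proof
  assume "a \<in> finite_length"
  then have fin: "atom_length a < \<infinity>" by (simp add: finite_length_def)
  show "\<exists>n. natoms n a"
  proof (cases "a \<in> ring_units")
    case True
    then show ?thesis by (intro exI[of _ 0]) simp
  next
    case False
    have "{enat (length ps) | ps. set ps \<subseteq> atoms \<and> prod_list ps = a} \<noteq> {}"
    proof
      assume "{enat (length ps) | ps. set ps \<subseteq> atoms \<and> prod_list ps = a} = {}"
      then have "atom_length a = \<infinity>"
        unfolding atom_length_def using False by (simp add: Inf_enat_def)
      with fin show False by simp
    qed
    then show ?thesis using natoms_prod_list by blast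
  qed
next
  assume "\<exists>n. natoms n a"
  then show "a \<in> finite_length" using atom_length_natoms by (auto simp: finite_length_def)
qed

declare natoms.simps(2) [simp del]

lemma L_eq_Inter_iff:
  "L m = (\<Inter>p\<in>B. L p) \<longleftrightarrow> (\<forall>p\<in>B. m \<in> L p) \<and> (\<forall>z. (\<forall>p\<in>B. z \<in> L p) \<longrightarrow> z \<in> L m)"
  (is "?l \<longleftrightarrow> ?r")
proof
  show "?l \<Longrightarrow> ?r" using L_self[of m] by blast
  show "?r \<Longrightarrow> ?l" using L_trans by blast
qed

section \<open>Intersections of maximal principal left ideals\<close>

text \<open>Intersecting with Rp either changes nothing or adds exactly one atom to the generator.
  This is the second case, on which the counting of independent atoms rests.\<close>

lemma L_Int_atom:
  fixes m p :: "'a::two_fir"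
  assumes "natoms k m" "p \<in> atoms" "f \<noteq> 0" "f \<in> L m" "f \<in> L p" "m \<notin> L p"
  obtains p' where "p' \<in> atoms" "rmult_iso p' p m" "L (p' * m) = L m \<inter> L p" "natoms (Suc k) (p' * m)"
proof -
  obtain u v where "u * m + v * p = 1" using coprime_atom assms by metis
  then obtain p' where p': "rmult_iso p' p m" "L (p' * m) = L m \<inter> L p"
    using coprime_lcm[OF assms(3-5)] by metis
  then have "p' \<in> atoms" using rmult_iso_inverse rmult_iso_atom assms(2) by metis
  then show thesis using that p' natoms_mult[of "Suc 0" p' k m] assms(1) natoms_one_iff[of p'] by simp
qed

lemma lcm_atoms:
  fixes f :: "'a::two_fir"
  assumes "finite B" "B \<subseteq> atoms" "f \<noteq> 0" "f \<in> (\<Inter>p\<in>B. L p)"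
  shows "\<exists>m k. L m = (\<Inter>p\<in>B. L p) \<and> natoms k m \<and> k \<le> card B"
  using assms
proof (induction B rule: finite_induct)
  case empty
  show ?case by (intro exI[of _ 1] exI[of _ 0]) simp
next
  case (insert p B)
  then obtain m k where mk: "L m = (\<Inter>p\<in>B. L p)" "natoms k m" "k \<le> card B" by auto
  show ?case
  proof (cases "m \<in> L p")
    case True
    then have "L m = (\<Inter>p\<in>insert p B. L p)" using mk(1) L_subset_iff[of m p] by (metis INT_insert inf.absorb2)
    moreover have "k \<le> card (insert p B)" using mk(3) insert.hyps by simp
    ultimately show ?thesis using mk(2) by blast
  next
    case False
    have "f \<in> L m" "f \<in> L p" "p \<in> atoms" using mk insert.prems by auto
    then obtain p' where "L (p' * m) = L m \<inter> L p" "natoms (Suc k) (p' * m)"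
      using L_Int_atom[OF mk(2) _ \<open>f \<noteq> 0\<close> _ _ False] by metis
    then show ?thesis using mk insert.hyps
      by (intro exI[of _ "p' * m"] exI[of _ "Suc k"]) auto
  qed
qed

text \<open>Let \<open>a\<close> generate the intersection over the smaller set and suppose
  \<open>a\<close> is not in Rq. Then \<open>p\<close> and \<open>q\<close> yield atoms p', q' with
  Rm = Rp'a contained in Rq'a; cancelling \<open>a\<close> gives Rp' = Rq', so p, p', q', q are all
  similar.\<close>

lemma atom_dvd_lcm_similar:
  fixes m :: "'a::two_fir"
  assumes "finite B" "B \<subseteq> atoms" "L m = (\<Inter>p\<in>B. L p)" "m \<noteq> 0" "q \<in> atoms" "m \<in> L q"
  shows "\<exists>p\<in>B. \<exists>t. rmult_iso p q t"
  using assms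
proof (induction B arbitrary: m rule: finite_induct)
  case empty
  then have "1 \<in> L q" using L_trans[of 1 m q] by auto
  then show ?case using atoms_nonunit[OF empty(4)] ring_units_iff by blast
next
  case (insert p B)
  have m: "m \<in> (\<Inter>p\<in>B. L p)" "m \<in> L p" using insert.prems L_self by blast+
  obtain a k where a: "L a = (\<Inter>p\<in>B. L p)" "natoms k a"
    using lcm_atoms[OF insert.hyps(1) _ insert.prems(3) m(1)] insert.prems(1) by blast
  have "a \<noteq> 0" using a natoms_nonzero by blast
  show ?case
  proof (cases "a \<in> L q")
    case True
    then show ?thesis using insert.IH[OF _ a(1) \<open>a \<noteq> 0\<close>] insert.prems by auto
  next
    case False
    have ma: "m \<in> L a" using a m by simp
    obtain q' where q': "q' \<in> atoms" "rmult_iso q' q a" "L (q' * a) = L a \<inter> L q"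
      using L_Int_atom[OF a(2) insert.prems(4,3) ma insert.prems(5) False] by metis
    have "a \<notin> L p"
      using False insert.prems a L_trans by (metis INT_insert IntI L_self)
    then obtain p' where p': "p' \<in> atoms" "rmult_iso p' p a" "L (p' * a) = L a \<inter> L p"
      using L_Int_atom[OF a(2) _ insert.prems(3) ma m(2)] insert.prems(1) by (metis insert_subset)
    have "L m = L (p' * a)" using p' insert.prems a by auto
    then have "p' * a \<in> L (q' * a)" using q'(3) ma insert.prems(5) by (metis IntI L_self L_trans)
    then have "p' \<in> L q'" using L_mult_cancel \<open>a \<noteq> 0\<close> by blast
    then have "L p' = L q'" using atom_L_subset p' q' atoms_nonunit by blast
    then have "rmult_iso p' q' 1" by (rule rmult_iso_L_cong)
    moreover obtain s where "rmult_iso p p' s" using rmult_iso_inverse[OF p'(2)] by metis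
    ultimately show ?thesis using q'(2) rmult_iso_trans by blast
  qed
qed

lemma V_atoms_iff: "p \<in> V_atoms f \<longleftrightarrow> p \<in> atoms \<and> f \<in> L p"
  by (auto simp: V_atoms_def)

lemma natoms_le:
  fixes f :: "'a::two_fir"
  assumes "natoms n f" "f \<in> L m" "natoms k m"
  shows "k \<le> n" and "k = n \<Longrightarrow> L f = L m"
proof -
  obtain e where e: "f = e * m" using assms(2) by (auto simp: mem_L_iff)
  then obtain j l where jl: "n = j + l" "natoms j e" "natoms l m" using natoms_factor assms(1) by blast
  then have "l = k" using assms(3) natoms_unique by blast
  then show "k \<le> n" using jl by simp
  show "L f = L m" if "k = n"
    using that jl \<open>l = k\<close> e L_unit_mult by simp
qed

lemma natoms_divisor:
  fixes f :: "'a::two_fir"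
  assumes "natoms n f" "f \<in> L m"
  obtains k where "natoms k m"
  using assms natoms_factor by (metis mem_L_iff)

text \<open>A set of atoms is \<open>F\<close>-independent iff the length of its least common left multiple is its
  cardinality.\<close>

definition independent_atoms :: "'a::ring_1 set \<Rightarrow> 'a \<Rightarrow> bool" where
  "independent_atoms B m \<longleftrightarrow>
     finite B \<and> B \<subseteq> atoms \<and> L m = (\<Inter>p\<in>B. L p) \<and> natoms (card B) m"

lemma independent_atoms_insert:
  fixes m :: "'a::two_fir"
  assumes B: "independent_atoms B m" and "p \<in> atoms" "f \<noteq> 0" "f \<in> L m" "f \<in> L p" "m \<notin> L p"
  obtains p' where "independent_atoms (insert p B) (p' * m)"
proof -
  have "p \<notin> B" using assms by (auto simp: independent_atoms_def)
  then show thesis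
    using L_Int_atom[of "card B" m p f] assms that unfolding independent_atoms_def
    by (metis INT_insert card_insert_disjoint finite_insert inf_commute insert_subset)
qed

text \<open>\<open>m\<close> has one atom more than \<open>B\<close> has elements, whereas the
  intersection over \<open>B\<close> has a generator of length at most \<open>card B\<close>. So Rp
  must cut it properly, and since this adds just one atom, the bound is attained.\<close>

lemma independent_atoms_remove:
  fixes m :: "'a::two_fir"
  assumes B: "independent_atoms (insert p B) m" and "p \<notin> B"
  obtains m' where "independent_atoms B m'" "m' \<notin> L p"
proof -
  have fin: "finite B" "B \<subseteq> atoms" "p \<in> atoms" and m: "natoms (Suc (card B)) m"
    "L m = L p \<inter> (\<Inter>p\<in>B. L p)"
    using assms by (auto simp: independent_atoms_def)
  have mem: "m \<in> (\<Inter>p\<in>B. L p)" "m \<in> L p" using m(2) L_self by blast+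
  have nz: "m \<noteq> 0" using m natoms_nonzero by blast
  obtain m' k where m': "L m' = (\<Inter>p\<in>B. L p)" "natoms k m'" "k \<le> card B"
    using lcm_atoms[OF fin(1,2) nz mem(1)] by blast
  have "m' \<notin> L p"
  proof
    assume "m' \<in> L p"
    then have "L m = L m'" using m m' L_subset_iff by blast
    then have "natoms (Suc (card B)) m'" using m natoms_L_cong by blast
    then show False using m' natoms_unique by fastforce
  qed
  moreover have "k = card B"
  proof -
    have "m \<in> L m'" using mem m' by blast
    then obtain p' where "L (p' * m') = L m' \<inter> L p" "natoms (Suc k) (p' * m')"
      using L_Int_atom[OF m'(2) fin(3) nz _ mem(2)] \<open>m' \<notin> L p\<close> by metis
    moreover from this have "L (p' * m') = L m" using m m' by auto
    ultimately show ?thesis using m(1) natoms_L_cong natoms_unique by blast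
  qed
  ultimately show thesis using that fin m' by (auto simp: independent_atoms_def)
qed

text \<open>An independent subset of V(f) has at most \<open>n\<close> elements, because its least
  common left multiple is a right factor of \<open>f\<close>. For a subset of greatest cardinality
  no further atom of V(f) can raise the length, so all of them right-divide
  \<open>m\<close>.\<close>

lemma independent_V_atoms:
  fixes f :: "'a::two_fir"
  assumes "natoms n f"
  obtains B m where "B \<subseteq> V_atoms f" "independent_atoms B m" "L m = (\<Inter>p\<in>V_atoms f. L p)"
proof -
  define P where "P k \<longleftrightarrow> (\<exists>B m. B \<subseteq> V_atoms f \<and> independent_atoms B m \<and> card B = k)" for k
  have bound: "k \<le> n" if "P k" for k
  proof -
    obtain B m where "B \<subseteq> V_atoms f" "independent_atoms B m" "card B = k"
      using \<open>P k\<close> by (auto simp: P_def)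
    then have "natoms k m" "f \<in> L m" by (auto simp: independent_atoms_def V_atoms_iff)
    then show ?thesis using natoms_le assms by blast
  qed
  have "P 0" unfolding P_def by (intro exI[of _ "{}"] exI[of _ 1]) (simp add: independent_atoms_def)
  then obtain k where k: "P k" "\<And>j. P j \<Longrightarrow> j \<le> k"
    using bound by (metis GreatestI_nat Greatest_le_nat)
  then obtain B m where B: "B \<subseteq> V_atoms f" "independent_atoms B m" "card B = k"
    by (auto simp: P_def)
  have fm: "f \<in> L m" using B by (auto simp: independent_atoms_def V_atoms_iff)
  have "m \<in> L p" if "p \<in> V_atoms f" for p
  proof (rule ccontr)
    assume nm: "m \<notin> L p"
    obtain p' where p': "independent_atoms (insert p B) (p' * m)"
      using independent_atoms_insert[OF B(2) _ natoms_nonzero[OF assms] fm _ nm] \<open>p \<in> V_atoms f\<close>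
      by (auto simp: V_atoms_iff)
    have "p \<notin> B" using nm B by (auto simp: independent_atoms_def)
    then have "card (insert p B) = Suc k" using B by (auto simp: independent_atoms_def)
    then have "P (Suc k)" using p' B \<open>p \<in> V_atoms f\<close> unfolding P_def by blast
    then show False using k(2) by fastforce
  qed
  then have "L m = (\<Inter>p\<in>V_atoms f. L p)"
    using B unfolding independent_atoms_def L_eq_Inter_iff by (meson subsetD)
  then show thesis using that B by blast
qed

section \<open>Fully reducible elements\<close>

text \<open>The atoms of any witnessing list lie in V(f), which squeezes the intersection over V(f);
  conversely \<open>independent_V_atoms\<close> extracts a finite family with the same intersection.
  A canonical family thus replaces the existential.\<close>

lemma fully_reducible_iff_V_atoms:
  fixes f :: "'a::two_fir"
  assumes "natoms n f"
  shows "fully_reducible f \<longleftrightarrow> L f = (\<Inter>p\<in>V_atoms f. L p)"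
proof
  assume "fully_reducible f"
  then obtain ps where "set ps \<subseteq> atoms" and ps: "L f = (\<Inter>p\<in>set ps. L p)"
    by (auto simp: fully_reducible_def)
  moreover have "f \<in> (\<Inter>p\<in>set ps. L p)" using ps L_self by blast
  ultimately have "set ps \<subseteq> V_atoms f" by (auto simp: V_atoms_iff)
  then have "(\<Inter>p\<in>V_atoms f. L p) \<subseteq> L f" using ps by blast
  moreover have "L f \<subseteq> (\<Inter>p\<in>V_atoms f. L p)" using L_trans by (auto simp: V_atoms_iff)
  ultimately show "L f = (\<Inter>p\<in>V_atoms f. L p)" by blast
next
  assume f: "L f = (\<Inter>p\<in>V_atoms f. L p)"
  obtain B m where B: "independent_atoms B m" "L m = (\<Inter>p\<in>V_atoms f. L p)"
    using independent_V_atoms[OF assms] by metis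
  then obtain ps where "set ps = B" using finite_list unfolding independent_atoms_def by metis
  then show "fully_reducible f"
    using f B assms unfolding fully_reducible_def independent_atoms_def finite_length_iff by metis
qed

lemma fully_reducible_separates:
  fixes f :: "'a::two_fir"
  assumes "natoms n f" "fully_reducible f" "x \<notin> L f"
  obtains p where "p \<in> atoms" "f \<in> L p" "x \<notin> L p"
proof -
  have "x \<notin> (\<Inter>p\<in>V_atoms f. L p)" using assms fully_reducible_iff_V_atoms by blast
  then show thesis using that by (auto simp: V_atoms_iff)
qed

lemma fully_reducible_finite_length: "fully_reducible f \<Longrightarrow> f \<in> finite_length"
  by (simp add: fully_reducible_def)

lemma fully_reducible_natoms:
  fixes f :: "'a::two_fir"
  shows "fully_reducible f \<Longrightarrow> \<exists>n. natoms n f"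
  using fully_reducible_finite_length finite_length_iff by blast

lemma fully_reducible_unit:
  fixes f :: "'a::two_fir"
  shows "f \<in> ring_units \<Longrightarrow> fully_reducible f"
  by (auto simp: fully_reducible_def finite_length_iff ring_units_L
      intro!: exI[of _ 0] exI[of _ "[]"])

lemma fully_reducible_atom:
  fixes f :: "'a::two_fir"
  shows "f \<in> atoms \<Longrightarrow> fully_reducible f"
  using natoms_one_iff[of f] unfolding fully_reducible_def finite_length_iff
  by (auto intro!: exI[of _ "Suc 0"] exI[of _ "[f]"])

lemma fully_reducible_Int:
  fixes f :: "'a::two_fir"
  assumes "natoms n f" "L f = L g \<inter> L h" "fully_reducible g" "fully_reducible h"
  shows "fully_reducible f"
proof -
  obtain ps qs where "set ps \<subseteq> atoms" "L g = (\<Inter>p\<in>set ps. L p)" "set qs \<subseteq> atoms"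
    "L h = (\<Inter>p\<in>set qs. L p)"
    using assms by (auto simp: fully_reducible_def)
  then have "set (ps @ qs) \<subseteq> atoms" "L f = (\<Inter>p\<in>set (ps @ qs). L p)" using assms(2) by auto
  then show ?thesis using assms(1) unfolding fully_reducible_def finite_length_iff by blast
qed

text \<open>Each p in V(a) corresponds under the isomorphism to some p' in V(b). If z lies in all
  Rp', its preimage lies in all Rp, hence in Ra.\<close>

lemma fully_reducible_rmult_iso:
  fixes a b :: "'a::two_fir"
  assumes iso: "rmult_iso a b t" and a: "fully_reducible a"
  shows "fully_reducible b"
proof -
  obtain n where n: "natoms n a" "natoms n b"
    using a fully_reducible_natoms rmult_iso_natoms[OF iso] by blast
  have "z \<in> L b" if z: "z \<in> (\<Inter>p\<in>V_atoms b. L p)" for z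
  proof -
    obtain u v where uv: "u * t + v * b = 1" using iso by (auto simp: rmult_iso_def)
    \<comment> \<open>\<open>w\<close> represents the preimage of z + Rb: the Bezout coefficient
      \<open>u\<close> inverts \<open>t\<close>.\<close>
    define w where "w = z * u"
    have w: "w * t - z \<in> L b"
    proof -
      have "w * t - z * (u * t + v * b) = - (z * v) * b"
        by (simp add: w_def algebra_simps)
      then show ?thesis using uv by (metis L_multI mult_1_right)
    qed
    have "w \<in> L p" if "p \<in> V_atoms a" for p
    proof -
      obtain c where c: "a = c * p" using \<open>p \<in> V_atoms a\<close> by (auto simp: V_atoms_iff mem_L_iff)
      obtain c' p' where p': "b = c' * p'" "rmult_iso p p' t"
        using rmult_iso_factor[OF iso natoms_nonzero[OF n(1)] c] by metis
      then have "p' \<in> V_atoms b"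
        using \<open>p \<in> V_atoms a\<close> rmult_iso_atom by (auto simp: V_atoms_iff)
      then have "z \<in> L p'" using z by blast
      moreover have "w * t - z \<in> L p'" using w p'(1) L_trans by blast
      ultimately have "w * t \<in> L p'" using L_cong by blast
      then show ?thesis using rmult_iso_D[OF p'(2)] by blast
    qed
    then have "w \<in> L a" using a n fully_reducible_iff_V_atoms by blast
    then have "w * t \<in> L b" using rmult_iso_D[OF iso] by blast
    then show ?thesis using w L_cong by blast
  qed
  then have "L b = (\<Inter>p\<in>V_atoms b. L p)" by (auto simp: L_eq_Inter_iff V_atoms_iff)
  then show ?thesis using n fully_reducible_iff_V_atoms by blast
qed

section \<open>Passage to factors\<close>

lemma fully_reducible_left_factor:
  fixes x y :: "'a::two_fir"
  assumes f: "fully_reducible (x * y)"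
  shows "fully_reducible x"
proof -
  obtain n where n: "natoms n (x * y)" using f fully_reducible_natoms by blast
  then obtain k l where kl: "natoms k x" "natoms l y" using natoms_factor by blast
  have nz: "x * y \<noteq> 0" "y \<noteq> 0" using natoms_nonzero[OF n] by auto
  \<comment> \<open>Right multiplication by \<open>y\<close> embeds R/Rx into R/Rxy, so
    \<open>z * y\<close> is tested against V(xy). An atom p with y in Rp imposes no condition; any
    other is pulled back by \<open>atom_colon\<close> to an atom of V(x).\<close>
  have "z \<in> L x" if z: "z \<in> (\<Inter>p\<in>V_atoms x. L p)" for z
  proof -
    have "z * y \<in> L p" if p: "p \<in> V_atoms (x * y)" for p
    proof (cases "y \<in> L p")
      case False
      have "p \<in> atoms" "x * y \<in> L p" using p by (auto simp: V_atoms_iff)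
      then obtain p' where p': "p' \<in> atoms" "rmult_iso p' p y"
        using atom_colon[of x y p] nz False by auto
      then have "p' \<in> V_atoms x"
        using \<open>x * y \<in> L p\<close> rmult_iso_D[OF p'(2)] by (simp add: V_atoms_iff)
      then have "z \<in> L p'" using z by blast
      then show ?thesis using rmult_iso_D[OF p'(2)] by blast
    qed (rule L_mult_left)
    then have "z * y \<in> L (x * y)" using f n fully_reducible_iff_V_atoms by blast
    then show ?thesis using nz L_mult_cancel by blast
  qed
  then have "L x = (\<Inter>p\<in>V_atoms x. L p)" by (auto simp: L_eq_Inter_iff V_atoms_iff)
  then show ?thesis using kl fully_reducible_iff_V_atoms by blast
qed

text \<open>Stripping off one atom \<open>x\<close> from \<open>f = x y\<close>: some \<open>Rp \<supseteq> Rf\<close> does not contain \<open>y\<close>, so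
  \<open>Rf = Rp \<inter> Ry\<close> and \<open>y\<close> is similar to the left cofactor of \<open>p\<close> in \<open>f\<close>.\<close>

lemma fully_reducible_right_factor_atom:
  fixes x y :: "'a::two_fir"
  assumes f: "fully_reducible (x * y)" and x: "x \<in> atoms"
  shows "fully_reducible y"
proof -
  obtain n where n: "natoms n (x * y)" using f fully_reducible_natoms by blast
  have nz: "x * y \<noteq> 0" "y \<noteq> 0" using natoms_nonzero[OF n] by auto
  have "y \<notin> L (x * y)"
    using L_mult_cancel[of y 1 x] nz atoms_nonunit[OF x] by (simp add: ring_units_iff)
  then obtain p where p: "p \<in> atoms" "x * y \<in> L p" "y \<notin> L p"
    using fully_reducible_separates[OF n f] by blast
  obtain u v where "u * y + v * p = 1"
    using coprime_atom[OF nz(1) L_multI p(2,1,3)] by blast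
  then obtain p' y' where py: "p' * y = y' * p" "L (p' * y) = L y \<inter> L p" "rmult_iso p' p y"
    "rmult_iso y' y p"
    using coprime_lcm[OF nz(1) L_multI p(2)] by metis
  have "p' \<in> atoms" using py(3) p(1) rmult_iso_inverse rmult_iso_atom by metis
  have "x * y \<in> L (p' * y)" using py(2) p(2) by auto
  then have "x \<in> L p'" using nz L_mult_cancel by blast
  then obtain w where w: "x = w * p'" by (auto simp: mem_L_iff)
  have "fully_reducible (w * y' * p)" using f w py(1) by (simp add: mult.assoc)
  then have "fully_reducible (w * y')" by (rule fully_reducible_left_factor)
  moreover have "w \<in> ring_units"
    using w x \<open>p' \<in> atoms\<close> atoms_nonunit by (auto simp: atoms_iff)
  then have "L (w * y') = L y'" by (rule L_unit_mult)
  ultimately have "fully_reducible y'" using fully_reducible_rmult_iso rmult_iso_L_cong by metis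
  then show ?thesis using py(4) fully_reducible_rmult_iso by blast
qed

lemma fully_reducible_right_factor:
  fixes x y :: "'a::two_fir"
  assumes "fully_reducible (x * y)"
  shows "fully_reducible y"
proof -
  obtain n where "natoms n (x * y)" using assms fully_reducible_natoms by blast
  then obtain k where "natoms k x" using natoms_factor by blast
  then show ?thesis using assms
  proof (induction k arbitrary: x y)
    case 0
    then have "L (x * y) = L y" using L_unit_mult by simp
    then show ?case using 0 fully_reducible_rmult_iso rmult_iso_L_cong by blast
  next
    case (Suc k)
    then obtain g p where gp: "natoms k g" "p \<in> atoms" "x = g * p"
      using natoms.simps(2) by blast
    then have "fully_reducible (p * y)" using Suc by (metis mult.assoc)
    then show ?case using fully_reducible_right_factor_atom gp by blast
  qed
qed

lemma fully_reducible_factor: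
  fixes g :: "'a::two_fir"
  shows "fully_reducible (p * g * q) \<Longrightarrow> fully_reducible g"
  using fully_reducible_left_factor fully_reducible_right_factor by blast

lemma natoms_Suc_left:
  fixes f :: "'a::ring_1_no_zero_divisors"
  shows "natoms (Suc n) f \<Longrightarrow> \<exists>a g. a \<in> atoms \<and> natoms n g \<and> f = a * g"
proof (induction n arbitrary: f)
  case 0
  then have "f \<in> atoms" using natoms_one_iff by blast
  then show ?case by (intro exI[of _ f] exI[of _ 1]) simp
next
  case (Suc n)
  then obtain g p where gp: "natoms (Suc n) g" "p \<in> atoms" "f = g * p"
    using natoms.simps(2)[of "Suc n" f] by blast
  then obtain a g' where "a \<in> atoms" "natoms n g'" "g = a * g'" using Suc.IH by blast
  moreover from this have "natoms (Suc n) (g' * p)" using gp natoms.simps(2) by blast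
  ultimately show ?case using gp by (metis mult.assoc)
qed

text \<open>Write \<open>f = a q b\<close> with atoms \<open>a, q\<close>. Since \<open>a q\<close> is fully reducible, \<open>Raq = Rq \<inter> Rq'\<close>, so
  \<open>Rf = Rqb \<inter> Rq'b\<close>.\<close>

lemma fully_reducible_if_neighbouring_atoms:
  fixes f :: "'a::two_fir"
  assumes "natoms n f"
    and "\<And>p g h q. g \<in> atoms \<Longrightarrow> h \<in> atoms \<Longrightarrow> f = p * g * h * q \<Longrightarrow> fully_reducible (g * h)"
  shows "fully_reducible f"
  using assms
proof (induction n arbitrary: f)
  case 0
  then show ?case using fully_reducible_unit by simp
next
  case (Suc n)
  \<comment> \<open>The hypothesis on neighbouring atoms is inherited by right factors, so the
    induction hypothesis covers both \<open>q * b\<close> and \<open>p * b\<close>.\<close>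
  have right: "fully_reducible y" if "f = x * y" "natoms n y" for x y
    using Suc.IH[OF that(2)] Suc.prems(2) that(1) by (metis mult.assoc)
  obtain a g where ag: "a \<in> atoms" "natoms n g" "f = a * g"
    using natoms_Suc_left Suc.prems(1) by blast
  show ?case
  proof (cases n)
    case 0
    then show ?thesis using Suc.prems(1) natoms_one_iff fully_reducible_atom by blast
  next
    case (Suc m)
    then obtain q b where qb: "q \<in> atoms" "natoms m b" "g = q * b"
      using natoms_Suc_left ag(2) by blast
    have f: "f = 1 * a * q * b" using ag qb by (simp add: mult.assoc)
    have aq: "fully_reducible (a * q)" using Suc.prems(2)[OF ag(1) qb(1) f] .
    have naq: "natoms 2 (a * q)"
      using natoms_mult[of 1 a 1 q] ag qb by (simp add: natoms_one_iff numeral_2_eq_2)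
    have nz: "a * q \<noteq> 0" "q \<noteq> 0" "b \<noteq> 0" using natoms_nonzero[OF naq] natoms_nonzero[OF qb(2)] by auto
    have "q \<notin> L (a * q)"
      using L_mult_cancel[of q 1 a] nz atoms_nonunit[OF ag(1)] by (simp add: ring_units_iff)
    then obtain p where p: "p \<in> atoms" "a * q \<in> L p" "q \<notin> L p"
      using fully_reducible_separates[OF naq aq] by blast
    have "natoms (Suc 0) q" using qb natoms_one_iff by blast
    then obtain p' where p': "L (p' * q) = L q \<inter> L p" "natoms (Suc (Suc 0)) (p' * q)"
      using L_Int_atom[OF _ p(1) nz(1) L_multI p(2,3)] by metis
    \<comment> \<open>One ideal contains the other and both generators have length 2.\<close>
    have "L (a * q) = L (p' * q)"
      using natoms_le(2)[OF naq _ p'(2)] p(2) p'(1) by (simp add: numeral_2_eq_2)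
    then have Laq: "L (a * q) = L q \<inter> L p" using p' by simp
    obtain h where h: "a * q = h * p" using p(2) by (auto simp: mem_L_iff)
    have fh: "f = h * (p * b)" using f h by (simp flip: mult.assoc)
    have "natoms n (p * b)"
      using natoms_mult[of 1 p m b] p(1) qb(2) Suc by (simp add: natoms_one_iff)
    then have "fully_reducible (p * b)" using right fh by blast
    moreover have "fully_reducible (q * b)" using right ag qb by blast
    moreover have "L f = L (q * b) \<inter> L (p * b)"
    proof (intro equalityI subsetI)
      fix z assume "z \<in> L f"
      moreover have "f \<in> L (p * b)" "f \<in> L (q * b)" using fh ag(3) qb(3) L_multI by metis+
      ultimately show "z \<in> L (q * b) \<inter> L (p * b)" using L_trans by blast
    next
      fix z assume z: "z \<in> L (q * b) \<inter> L (p * b)"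
      then obtain r where r: "z = r * b" using L_trans[of z "q * b" b] by (auto simp: mem_L_iff)
      then have "r \<in> L (a * q)" using z Laq nz L_mult_cancel by blast
      then have "r * b \<in> L (a * q * b)" using nz L_mult_cancel by blast
      then show "z \<in> L f" using r f by simp
    qed
    ultimately show ?thesis using fully_reducible_Int Suc.prems(1) by blast
  qed
qed

section \<open>\<open>F\<close>-dependence and rank\<close>

lemma F_algebraic_subset_V_atoms:
  fixes f :: "'a::two_fir"
  assumes "f \<noteq> 0" "D \<subseteq> V_atoms f"
  shows "F_algebraic D"
proof -
  have "D \<subseteq> finite_length - ring_units"
  proof
    fix p assume "p \<in> D"
    then have "p \<in> atoms" using assms by (auto simp: V_atoms_iff)
    then show "p \<in> finite_length - ring_units"
      using natoms_one_iff atoms_nonunit finite_length_iff by blast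
  qed
  moreover have "f \<in> (\<Inter>d\<in>D. L d)" using assms by (auto simp: V_atoms_iff)
  ultimately show ?thesis using assms(1) by (auto simp: F_algebraic_def)
qed

text \<open>The intersection is Rm for some \<open>m\<close>, and Rp + Rm is R unless m lies in Rp,
  where it is Rp. Dependence among atoms is thus mere containment.\<close>

lemma F_dependent_iff:
  fixes f :: "'a::two_fir"
  assumes f: "f \<noteq> 0" and V: "insert p D \<subseteq> V_atoms f"
  shows "F_dependent p D \<longleftrightarrow> (\<exists>G. finite G \<and> G \<subseteq> D \<and> (\<Inter>g\<in>G. L g) \<subseteq> L p)"
proof -
  have "L p + (\<Inter>g\<in>G. L g) \<noteq> UNIV \<longleftrightarrow> (\<Inter>g\<in>G. L g) \<subseteq> L p" if G: "finite G" "G \<subseteq> D" for G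
  proof
    assume sub: "(\<Inter>g\<in>G. L g) \<subseteq> L p"
    have "L p + (\<Inter>g\<in>G. L g) \<subseteq> L p"
      using sub L_add by (auto elim!: set_plus_elim)
    moreover have "p \<notin> ring_units" using V atoms_nonunit by (auto simp: V_atoms_iff)
    ultimately show "L p + (\<Inter>g\<in>G. L g) \<noteq> UNIV" using ring_units_L by blast
  next
    assume ne: "L p + (\<Inter>g\<in>G. L g) \<noteq> UNIV"
    have "G \<subseteq> atoms" "f \<in> (\<Inter>g\<in>G. L g)" and p: "p \<in> atoms" "f \<in> L p"
      using V G by (auto simp: V_atoms_iff)
    then obtain m where m: "L m = (\<Inter>g\<in>G. L g)"
      using lcm_atoms[OF G(1) _ f] by blast
    have "m \<in> L p"
    proof (rule ccontr)
      assume "m \<notin> L p"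
      then obtain u v where uv: "u * m + v * p = 1"
        using coprime_atom[OF f _ p(2,1)] m \<open>f \<in> (\<Inter>g\<in>G. L g)\<close> by blast
      have "x \<in> L p + L m" for x
      proof -
        have "x = (x * v) * p + (x * u) * m"
          using arg_cong[OF uv, of "\<lambda>z. x * z"] by (simp add: algebra_simps)
        then show ?thesis using set_plus_intro[OF L_multI[of "x * v" p] L_multI[of "x * u" m]] by simp
      qed
      then show False using ne m by auto
    qed
    then show "(\<Inter>g\<in>G. L g) \<subseteq> L p" using m L_subset_iff by blast
  qed
  then show ?thesis
    using F_algebraic_subset_V_atoms[OF f V] unfolding F_dependent_def by (metis (no_types))
qed

lemma F_independent_subset:
  fixes f :: "'a::two_fir"
  assumes f: "f \<noteq> 0" and "B \<subseteq> V_atoms f" "F_independent B" "A \<subseteq> B"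
  shows "F_independent A"
  unfolding F_independent_def
proof (intro conjI ballI)
  show "F_algebraic A" using F_algebraic_subset_V_atoms assms by blast
  fix d assume d: "d \<in> A"
  have V: "insert d (A - {d}) \<subseteq> V_atoms f" "insert d (B - {d}) \<subseteq> V_atoms f"
    using assms d by auto
  have "\<not> F_dependent d (B - {d})" using assms d by (auto simp: F_independent_def)
  then show "\<not> F_dependent d (A - {d})"
    unfolding F_dependent_iff[OF f V(1)] F_dependent_iff[OF f V(2)] using \<open>A \<subseteq> B\<close> by blast
qed

text \<open>Forward, atoms are added one at a time, each raising the length by one. Backward,
  removing \<open>d\<close> leaves a generator outside Rd, so no subfamily has its intersection
  inside Rd.\<close>

lemma F_independent_iff:
  fixes f :: "'a::two_fir"
  assumes f: "f \<noteq> 0" and "B \<subseteq> V_atoms f" "finite B"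
  shows "F_independent B \<longleftrightarrow> (\<exists>m. independent_atoms B m)"
proof
  show "F_independent B \<Longrightarrow> \<exists>m. independent_atoms B m"
    using assms(3,2)
  proof (induction B rule: finite_induct)
    case empty
    show ?case by (intro exI[of _ 1]) (simp add: independent_atoms_def)
  next
    case (insert p B)
    have "F_independent B" using F_independent_subset[OF f insert.prems(2,1)] by blast
    then obtain m where m: "independent_atoms B m" using insert by auto
    have "\<not> F_dependent p (insert p B - {p})" using insert.prems by (auto simp: F_independent_def)
    then have "\<not> F_dependent p B" using insert.hyps by simp
    then have "\<not> (\<Inter>g\<in>B. L g) \<subseteq> L p"
      using F_dependent_iff[OF f insert.prems(2)] insert.hyps(1) by blast
    then have "m \<notin> L p" using m L_subset_iff by (metis independent_atoms_def)
    moreover have "p \<in> atoms" "f \<in> L p" "f \<in> L m"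
      using insert.prems m by (auto simp: V_atoms_iff independent_atoms_def)
    ultimately show ?case using independent_atoms_insert[OF m _ f] by metis
  qed
next
  assume "\<exists>m. independent_atoms B m"
  then obtain m where m: "independent_atoms B m" by blast
  show "F_independent B"
    unfolding F_independent_def
  proof (intro conjI ballI notI)
    show "F_algebraic B" using F_algebraic_subset_V_atoms assms by blast
    fix d assume d: "d \<in> B" "F_dependent d (B - {d})"
    then have V: "insert d (B - {d}) \<subseteq> V_atoms f" using assms by auto
    obtain G where G: "G \<subseteq> B - {d}" "(\<Inter>g\<in>G. L g) \<subseteq> L d"
      using d F_dependent_iff[OF f V] by blast
    have "insert d (B - {d}) = B" using d by blast
    then obtain m' where m': "independent_atoms (B - {d}) m'" "m' \<notin> L d"
      using independent_atoms_remove[of d "B - {d}" m] m by auto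
    have "(\<Inter>g\<in>B - {d}. L g) \<subseteq> L d" using G by blast
    then show False using m' L_self[of m'] by (auto simp: independent_atoms_def)
  qed
qed

lemma F_independent_finite:
  fixes f :: "'a::two_fir"
  assumes n: "natoms n f" and B: "B \<subseteq> V_atoms f" "F_independent B"
  shows "finite B"
proof (rule ccontr)
  assume "infinite B"
  then obtain A where A: "A \<subseteq> B" "finite A" "card A = Suc n"
    using infinite_arbitrarily_large by metis
  have f: "f \<noteq> 0" using n natoms_nonzero by blast
  obtain m where m: "independent_atoms A m"
    using F_independent_iff[OF f _ A(2)] F_independent_subset[OF f B A(1)] A B by blast
  then have "natoms (Suc n) m" "f \<in> L m"
    using A B by (auto simp: independent_atoms_def V_atoms_iff)
  then show False using natoms_le(1)[OF n] by fastforce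
qed

text \<open>\<open>rk\<close> takes an arbitrary F-basis, and \<open>independent_V_atoms\<close>
  shows that one exists. Whichever is chosen, it is finite and has the same intersection as V(f), so
  its cardinality is the length of the generator.\<close>

lemma rk_V_atoms:
  fixes f :: "'a::two_fir"
  assumes n: "natoms n f"
  shows "\<exists>m k. L m = (\<Inter>p\<in>V_atoms f. L p) \<and> natoms k m \<and> rk (V_atoms f) = enat k"
proof -
  have f: "f \<noteq> 0" using n natoms_nonzero by blast
  \<comment> \<open>For finite \<open>B\<close> the best witness is \<open>G = B\<close>, since
    smaller sets have larger intersections.\<close>
  have dep: "F_dependent d B \<longleftrightarrow> (\<Inter>g\<in>B. L g) \<subseteq> L d"
    if "finite B" "B \<subseteq> V_atoms f" "d \<in> V_atoms f" for B d
  proof -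
    have V: "insert d B \<subseteq> V_atoms f" using that by auto
    show ?thesis
      unfolding F_dependent_iff[OF f V] using that(1) INF_superset_mono[of _ B L L]
      by (metis order_refl order_trans)
  qed
  obtain B0 m0 where B0: "B0 \<subseteq> V_atoms f" "independent_atoms B0 m0" "L m0 = (\<Inter>p\<in>V_atoms f. L p)"
    using independent_V_atoms[OF n] by metis
  then have fin: "finite B0" "(\<Inter>g\<in>B0. L g) = (\<Inter>p\<in>V_atoms f. L p)"
    by (auto simp: independent_atoms_def)
  have "F_basis B0 (V_atoms f)"
    unfolding F_basis_def
  proof (intro conjI ballI)
    show "F_independent B0" using B0(2) F_independent_iff[OF f B0(1) fin(1)] by blast
    show "F_dependent d B0" if "d \<in> V_atoms f" for d
      unfolding dep[OF fin(1) B0(1) that] fin(2) by (rule INF_lower[OF that])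
  qed (rule B0(1))
  then have B: "F_basis (SOME B. F_basis B (V_atoms f)) (V_atoms f)" (is "F_basis ?B _") by (rule someI)
  then have BV: "?B \<subseteq> V_atoms f" "F_independent ?B" by (simp_all add: F_basis_def)
  have finB: "finite ?B" using F_independent_finite[OF n BV] .
  obtain m where m: "independent_atoms ?B m" using F_independent_iff[OF f BV(1) finB] BV(2) by blast
  have "(\<Inter>g\<in>?B. L g) \<subseteq> L d" if "d \<in> V_atoms f" for d
    using B dep[OF finB BV(1) that] that by (auto simp: F_basis_def)
  then have "(\<Inter>g\<in>?B. L g) = (\<Inter>p\<in>V_atoms f. L p)" using BV(1) by blast
  then have "L m = (\<Inter>p\<in>V_atoms f. L p)" "natoms (card ?B) m"
    using m by (simp_all add: independent_atoms_def)
  moreover have "rk (V_atoms f) = enat (card ?B)" using finB by (simp add: rk_def ecard_def)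
  ultimately show ?thesis by blast
qed

lemma fully_reducible_iff_natoms:
  fixes f :: "'a::two_fir"
  assumes n: "natoms n f" and m: "L m = (\<Inter>p\<in>V_atoms f. L p)" "natoms k m"
  shows "fully_reducible f \<longleftrightarrow> k = n"
proof
  have "f \<in> L m" using m by (auto simp: V_atoms_iff)
  then show "k = n \<Longrightarrow> fully_reducible f"
    using natoms_le(2)[OF n _ m(2)] m(1) fully_reducible_iff_V_atoms[OF n] by simp
  assume "fully_reducible f"
  then have "L f = L m" using m(1) fully_reducible_iff_V_atoms[OF n] by simp
  then show "k = n" using natoms_L_cong[OF n] m(2) natoms_unique by blast
qed

lemma fully_reducible_iff_V_atoms_subset:
  fixes f :: "'a::two_fir"
  assumes n: "natoms n f"
  shows "fully_reducible f \<longleftrightarrow> (\<forall>g. g \<noteq> 0 \<and> V_atoms f \<subseteq> V_atoms g \<longrightarrow> g \<in> L f)"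
proof
  assume "fully_reducible f"
  then have "L f = (\<Inter>p\<in>V_atoms f. L p)" using fully_reducible_iff_V_atoms[OF n] by simp
  then show "\<forall>g. g \<noteq> 0 \<and> V_atoms f \<subseteq> V_atoms g \<longrightarrow> g \<in> L f" by (auto simp: V_atoms_iff)
next
  assume R: "\<forall>g. g \<noteq> 0 \<and> V_atoms f \<subseteq> V_atoms g \<longrightarrow> g \<in> L f"
  obtain m k where m: "L m = (\<Inter>p\<in>V_atoms f. L p)" "natoms k m" using rk_V_atoms[OF n] by blast
  then have "m \<in> (\<Inter>p\<in>V_atoms f. L p)" using L_self by blast
  then have "V_atoms f \<subseteq> V_atoms m" by (auto simp: V_atoms_iff)
  \<comment> \<open>The hypothesis is tested at the generator \<open>m\<close> itself.\<close>
  then have "m \<in> L f" using R natoms_nonzero[OF m(2)] by blast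
  moreover have "f \<in> L m" using m by (auto simp: V_atoms_iff)
  ultimately have "L f = L m" by (simp add: L_eq_iff)
  then show "fully_reducible f" using m(1) fully_reducible_iff_V_atoms[OF n] by simp
qed

section \<open>The modules \<open>R/Ra\<close>\<close>

lemma mem_coset_iff: "z \<in> x +o L a \<longleftrightarrow> z - x \<in> L a"
  by (force simp: elt_set_plus_def)

lemma coset_eq_iff: "x +o L a = y +o L a \<longleftrightarrow> x - y \<in> L a"
proof
  assume "x +o L a = y +o L a"
  moreover have "x \<in> x +o L a" by (simp add: mem_coset_iff)
  ultimately show "x - y \<in> L a" by (simp add: mem_coset_iff)
next
  assume xy: "x - y \<in> L a"
  have "z - x \<in> L a \<longleftrightarrow> z - y \<in> L a" for z
  proof -
    have "(z - y) - (z - x) \<in> L a" using xy by simp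
    then show ?thesis using L_cong by blast
  qed
  then show "x +o L a = y +o L a" by (auto simp: mem_coset_iff)
qed

lemma carrier_quot_mod: "carrier (quot_mod a) = range (\<lambda>x. x +o L a)"
  by (auto simp: quot_mod_def)

lemma zero_quot_mod: "\<zero>\<^bsub>quot_mod a\<^esub> = 0 +o L a"
  by (simp add: quot_mod_def)

lemma coset_in_carrier [simp]: "x +o L a \<in> carrier (quot_mod a)"
  by (simp add: carrier_quot_mod)

lemma coset_eq_zero_iff: "x +o L a = \<zero>\<^bsub>quot_mod a\<^esub> \<longleftrightarrow> x \<in> L a"
  by (simp add: zero_quot_mod coset_eq_iff del: set_zero_plus)

lemma quot_mod_abelian_group: "abelian_group (quot_mod a)"
proof (rule abelian_groupI)
  fix X assume "X \<in> carrier (quot_mod a)"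
  then obtain x where x: "X = x +o L a" by (auto simp: carrier_quot_mod)
  show "\<exists>Y\<in>carrier (quot_mod a). Y \<oplus>\<^bsub>quot_mod a\<^esub> X = \<zero>\<^bsub>quot_mod a\<^esub>"
    by (rule bexI[of _ "(- x) +o L a"]) (simp_all only: x quot_add coset_eq_zero_iff coset_in_carrier
        add.left_inverse L_zero)
qed (auto simp: carrier_quot_mod quot_add zero_quot_mod algebra_simps simp del: set_zero_plus)

text \<open>When \<open>a * t\<close> lies in Rb, multiplication by \<open>t\<close> maps a coset of
  Ra into a coset of Rb without necessarily filling it; adding \<open>L b\<close> completes
  it.\<close>

definition rmult_hom :: "'a::ring_1 \<Rightarrow> 'a \<Rightarrow> 'a \<Rightarrow> 'a set \<Rightarrow> 'a set" where
  "rmult_hom a b t = (\<lambda>X\<in>carrier (quot_mod a). (\<lambda>x. x * t) ` X + L b)"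

lemma rmult_hom_coset:
  assumes "a * t \<in> L b"
  shows "rmult_hom a b t (x +o L a) = (x * t) +o L b"
proof -
  have "(\<lambda>z. z * t) ` (x +o L a) + L b = (x * t) +o L b"
  proof (intro equalityI subsetI)
    fix z assume "z \<in> (\<lambda>z. z * t) ` (x +o L a) + L b"
    then obtain y s where ys: "y - x \<in> L a" "z = y * t + s" "s \<in> L b"
      by (auto simp: set_plus_def mem_coset_iff)
    then have "(y - x) * t \<in> L b"
      using assms by (metis L_mult_left mem_L_iff mult.assoc)
    then have "(y - x) * t + s \<in> L b" using ys L_add by blast
    then show "z \<in> (x * t) +o L b" using ys by (simp add: mem_coset_iff algebra_simps)
  next
    fix z assume "z \<in> (x * t) +o L b"
    then have z: "z - x * t \<in> L b" by (simp add: mem_coset_iff)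
    have "x * t \<in> (\<lambda>z. z * t) ` (x +o L a)" by (rule imageI) (simp add: mem_coset_iff)
    from set_plus_intro[OF this z] show "z \<in> (\<lambda>z. z * t) ` (x +o L a) + L b" by simp
  qed
  then show ?thesis by (simp add: rmult_hom_def)
qed

lemma rmult_hom_in_lmod_hom:
  assumes "a * t \<in> L b"
  shows "rmult_hom a b t \<in> lmod_hom (quot_mod a) (quot_mod b)"
  using assms unfolding lmod_hom_def
  by (auto simp: carrier_quot_mod rmult_hom_coset quot_add quot_smult algebra_simps)
     (auto simp: rmult_hom_def carrier_quot_mod)

text \<open>R/Ra is cyclic, so a homomorphism is determined by the image of the coset of 1;
  \<open>t\<close> is any representative of that image.\<close>

lemma lmod_hom_quot_modE:
  assumes "\<phi> \<in> lmod_hom (quot_mod a) (quot_mod b)"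
  obtains t where "a * t \<in> L b" "\<phi> = rmult_hom a b t"
proof -
  have "\<phi> (1 +o L a) \<in> carrier (quot_mod b)" using assms by (auto simp: lmod_hom_def)
  then obtain t where t: "\<phi> (1 +o L a) = t +o L b" by (auto simp: carrier_quot_mod)
  have hom: "\<phi> (x +o L a) = (x * t) +o L b" for x
  proof -
    have "\<phi> (x \<odot>\<^bsub>quot_mod a\<^esub> (1 +o L a)) = x \<odot>\<^bsub>quot_mod b\<^esub> \<phi> (1 +o L a)"
      using assms by (simp add: lmod_hom_def)
    then show ?thesis by (simp add: quot_smult t)
  qed
  have "a +o L a = 0 +o L a" unfolding coset_eq_iff by simp
  then have "(a * t) +o L b = (0 * t) +o L b" using hom by metis
  then have at: "a * t \<in> L b" unfolding coset_eq_iff by simp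
  have "\<phi> = rmult_hom a b t"
  proof (rule extensionalityI)
    show "\<phi> \<in> extensional (carrier (quot_mod a))" using assms by (auto simp: lmod_hom_def PiE_def)
    show "rmult_hom a b t \<in> extensional (carrier (quot_mod a))" by (simp add: rmult_hom_def)
    show "\<phi> X = rmult_hom a b t X" if "X \<in> carrier (quot_mod a)" for X
      using that at hom by (auto simp: carrier_quot_mod rmult_hom_coset)
  qed
  then show thesis using that at by blast
qed

text \<open>The equivalence in \<open>rmult_iso\<close> encodes that right multiplication by
  \<open>t\<close> is well defined and injective on cosets, the Bezout relation that it is
  onto.\<close>

lemma similar_iff: "similar a b \<longleftrightarrow> a \<noteq> 0 \<and> b \<noteq> 0 \<and> (\<exists>t. rmult_iso a b t)"
proof -
  have "rmult_iso a b t"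
    if t: "a * t \<in> L b" and bij: "bij_betw (rmult_hom a b t) (carrier (quot_mod a)) (carrier (quot_mod b))"
    for t
    unfolding rmult_iso_def
  proof (intro conjI allI)
    fix r
    have "r * t \<in> L b \<longleftrightarrow> rmult_hom a b t (r +o L a) = rmult_hom a b t (0 +o L a)"
      unfolding rmult_hom_coset[OF t] coset_eq_iff by simp
    also have "\<dots> \<longleftrightarrow> r +o L a = 0 +o L a"
      using bij by (intro inj_on_eq_iff[of _ "carrier (quot_mod a)"]) (auto simp: bij_betw_def simp del: set_zero_plus)
    also have "\<dots> \<longleftrightarrow> r \<in> L a" unfolding coset_eq_iff by simp
    finally show "r * t \<in> L b \<longleftrightarrow> r \<in> L a" .
  next
    have "1 +o L b \<in> rmult_hom a b t ` carrier (quot_mod a)"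
      using bij unfolding bij_betw_def by (metis coset_in_carrier)
    then obtain u where "1 +o L b = (u * t) +o L b"
      by (auto simp: carrier_quot_mod rmult_hom_coset[OF t])
    then obtain v where "1 - u * t = v * b" by (auto simp: coset_eq_iff mem_L_iff)
    then show "\<exists>u v. u * t + v * b = 1" by (metis add.commute diff_add_cancel)
  qed
  moreover have "lmod_iso (quot_mod a) (quot_mod b)" if iso: "rmult_iso a b t" for t
  proof -
    have t: "a * t \<in> L b" using rmult_iso_D[OF iso] by simp
    have "inj_on (rmult_hom a b t) (carrier (quot_mod a))"
    proof (rule inj_onI)
      fix X Y assume "X \<in> carrier (quot_mod a)" "Y \<in> carrier (quot_mod a)"
        and eq: "rmult_hom a b t X = rmult_hom a b t Y"
      then obtain x y where xy: "X = x +o L a" "Y = y +o L a" by (auto simp: carrier_quot_mod)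
      have "(x - y) * t \<in> L b"
        using eq unfolding xy rmult_hom_coset[OF t] coset_eq_iff by (simp add: algebra_simps)
      then show "X = Y" unfolding xy coset_eq_iff using rmult_iso_D[OF iso] by blast
    qed
    moreover have "carrier (quot_mod b) \<subseteq> rmult_hom a b t ` carrier (quot_mod a)"
    proof
      fix Y assume "Y \<in> carrier (quot_mod b)"
      then obtain y where y: "Y = y +o L b" by (auto simp: carrier_quot_mod)
      obtain u v where uv: "u * t + v * b = 1" using iso by (auto simp: rmult_iso_def)
      have "y - (y * u) * t = (y * v) * b"
        using arg_cong[OF uv, of "\<lambda>z. y * z"] by (simp add: algebra_simps)
      then have "Y = rmult_hom a b t ((y * u) +o L a)"
        unfolding rmult_hom_coset[OF t] y coset_eq_iff by simp
      then show "Y \<in> rmult_hom a b t ` carrier (quot_mod a)" by simp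
    qed
    moreover have "rmult_hom a b t ` carrier (quot_mod a) \<subseteq> carrier (quot_mod b)"
      by (auto simp: carrier_quot_mod rmult_hom_coset[OF t])
    ultimately show ?thesis
      unfolding lmod_iso_def using rmult_hom_in_lmod_hom[OF t]
      by (auto simp: bij_betw_def intro!: bexI[of _ "rmult_hom a b t"])
  qed
  ultimately show ?thesis unfolding similar_def lmod_iso_def using lmod_hom_quot_modE by metis
qed

section \<open>Endomorphism rings\<close>

lemma lmod_End_ring:
  fixes M :: "('r, 'm) module" (structure)
  assumes "abelian_group M"
    and smult_closed: "\<And>r x. x \<in> carrier M \<Longrightarrow> r \<odot>\<^bsub>M\<^esub> x \<in> carrier M"
    and smult_add: "\<And>r x y. x \<in> carrier M \<Longrightarrow> y \<in> carrier M \<Longrightarrow>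
      r \<odot>\<^bsub>M\<^esub> (x \<oplus> y) = r \<odot>\<^bsub>M\<^esub> x \<oplus> r \<odot>\<^bsub>M\<^esub> y"
  shows "ring (lmod_End M)"
proof -
  interpret abelian_group M by fact
  have smult_zero: "r \<odot>\<^bsub>M\<^esub> \<zero> = \<zero>" for r
  proof -
    have "r \<odot>\<^bsub>M\<^esub> \<zero> \<oplus> r \<odot>\<^bsub>M\<^esub> \<zero> = r \<odot>\<^bsub>M\<^esub> \<zero>" using smult_add[of \<zero> \<zero> r] by simp
    then show ?thesis using smult_closed[of \<zero> r] by (metis add.l_cancel_one' zero_closed)
  qed
  have smult_minus: "r \<odot>\<^bsub>M\<^esub> (\<ominus> x) = \<ominus> (r \<odot>\<^bsub>M\<^esub> x)" if "x \<in> carrier M" for r x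
  proof -
    have "r \<odot>\<^bsub>M\<^esub> (\<ominus> x) \<oplus> r \<odot>\<^bsub>M\<^esub> x = \<zero>"
      using smult_add[of "\<ominus> x" x r] smult_zero that by (simp add: l_neg)
    then show ?thesis using that smult_closed by (metis a_inv_closed minus_equality)
  qed
  let ?D = "lmod_End M"
  have mem: "h \<in> carrier ?D \<longleftrightarrow> h \<in> carrier M \<rightarrow>\<^sub>E carrier M \<and>
      (\<forall>x\<in>carrier M. \<forall>y\<in>carrier M. h (x \<oplus> y) = h x \<oplus> h y) \<and>
      (\<forall>r. \<forall>x\<in>carrier M. h (r \<odot>\<^bsub>M\<^esub> x) = r \<odot>\<^bsub>M\<^esub> h x)" for h
    by (simp add: lmod_End_def lmod_hom_def)
  have closed: "h x \<in> carrier M" if "h \<in> carrier ?D" "x \<in> carrier M" for h x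
    using that unfolding mem by auto
  have eqI: "g = h" if "g \<in> carrier ?D" "h \<in> carrier ?D" "\<And>x. x \<in> carrier M \<Longrightarrow> g x = h x" for g h
    using that unfolding mem by (metis PiE_ext)
  have hom_zero: "h \<zero> = \<zero>" if h: "h \<in> carrier ?D" for h
  proof -
    have "h \<zero> \<oplus> h \<zero> = h \<zero>" using h unfolding mem by (metis l_zero zero_closed)
    then show ?thesis using closed[OF h, of \<zero>] by (metis add.l_cancel_one' zero_closed)
  qed
  have hom_add: "h (x \<oplus> y) = h x \<oplus> h y"
    if "h \<in> carrier ?D" "x \<in> carrier M" "y \<in> carrier M" for h x y
    using that unfolding mem by blast
  have hom_smult: "h (r \<odot>\<^bsub>M\<^esub> x) = r \<odot>\<^bsub>M\<^esub> h x"
    if "h \<in> carrier ?D" "x \<in> carrier M" for h r x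
    using that unfolding mem by blast
  have memI: "(\<lambda>x\<in>carrier M. k x) \<in> carrier ?D"
    if "\<And>x. x \<in> carrier M \<Longrightarrow> k x \<in> carrier M"
      "\<And>x y. x \<in> carrier M \<Longrightarrow> y \<in> carrier M \<Longrightarrow> k (x \<oplus> y) = k x \<oplus> k y"
      "\<And>r x. x \<in> carrier M \<Longrightarrow> k (r \<odot>\<^bsub>M\<^esub> x) = r \<odot>\<^bsub>M\<^esub> k x" for k
    unfolding mem using that by (simp add: smult_closed)
  have ops: "g \<oplus>\<^bsub>?D\<^esub> h = (\<lambda>x\<in>carrier M. g x \<oplus> h x)" "g \<otimes>\<^bsub>?D\<^esub> h = (\<lambda>x\<in>carrier M. h (g x))"
    "\<one>\<^bsub>?D\<^esub> = (\<lambda>x\<in>carrier M. x)" "\<zero>\<^bsub>?D\<^esub> = (\<lambda>x\<in>carrier M. \<zero>)" for g h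
    by (simp_all add: lmod_End_def)
  have mems: "g \<oplus>\<^bsub>?D\<^esub> h \<in> carrier ?D" "g \<otimes>\<^bsub>?D\<^esub> h \<in> carrier ?D"
      "(\<lambda>x\<in>carrier M. \<ominus> (h x)) \<in> carrier ?D"
    if "g \<in> carrier ?D" "h \<in> carrier ?D" for g h
    unfolding ops
    by (intro memI; simp add: that closed hom_add hom_smult smult_add smult_closed
        smult_minus minus_add a_ac)+
  have const_mems: "\<one>\<^bsub>?D\<^esub> \<in> carrier ?D" "\<zero>\<^bsub>?D\<^esub> \<in> carrier ?D"
    unfolding ops by (intro memI; simp add: smult_zero)+
  have app: "(g \<oplus>\<^bsub>?D\<^esub> h) x = g x \<oplus> h x" "(g \<otimes>\<^bsub>?D\<^esub> h) x = h (g x)" "\<one>\<^bsub>?D\<^esub> x = x" "\<zero>\<^bsub>?D\<^esub> x = \<zero>"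
    if "x \<in> carrier M" for g h x
    using that by (simp_all add: lmod_End_def)
  note [simp] = mems const_mems app closed hom_add
  show ?thesis
  proof (rule ringI)
    show "abelian_group ?D"
    proof (rule abelian_groupI)
      fix h assume h: "h \<in> carrier ?D"
      have "(\<lambda>x\<in>carrier M. \<ominus> (h x)) \<oplus>\<^bsub>?D\<^esub> h = \<zero>\<^bsub>?D\<^esub>"
        using h mems(3)[OF h h] by (intro eqI) (simp_all add: l_neg)
      then show "\<exists>g\<in>carrier ?D. g \<oplus>\<^bsub>?D\<^esub> h = \<zero>\<^bsub>?D\<^esub>" using mems(3)[OF h h] by blast
    qed (simp | intro eqI | simp add: a_ac)+
    show "Group.monoid ?D"
      by (rule Group.monoidI) (simp | intro eqI)+
  qed (simp | intro eqI)+
qed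

lemma C_ring_ring: "ring (C_ring q)"
  unfolding C_ring_def
  by (rule lmod_End_ring[OF quot_mod_abelian_group])
     (auto simp: carrier_quot_mod quot_add quot_smult algebra_simps)

lemma C_ring_simps:
  "carrier (C_ring q) = lmod_hom (quot_mod q) (quot_mod q)"
  "X \<in> carrier (quot_mod q) \<Longrightarrow> (\<phi> \<otimes>\<^bsub>C_ring q\<^esub> \<psi>) X = \<psi> (\<phi> X)"
  "X \<in> carrier (quot_mod q) \<Longrightarrow> \<one>\<^bsub>C_ring q\<^esub> X = X"
  "X \<in> carrier (quot_mod q) \<Longrightarrow> \<zero>\<^bsub>C_ring q\<^esub> X = \<zero>\<^bsub>quot_mod q\<^esub>"
  by (simp_all add: C_ring_def lmod_End_def)

lemma C_ring_eqI:
  assumes "\<phi> \<in> carrier (C_ring q)" "\<psi> \<in> carrier (C_ring q)" "\<And>x. \<phi> (x +o L q) = \<psi> (x +o L q)"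
  shows "\<phi> = \<psi>"
proof (rule extensionalityI)
  show "\<phi> \<in> extensional (carrier (quot_mod q))" "\<psi> \<in> extensional (carrier (quot_mod q))"
    using assms(1,2) by (auto simp: C_ring_simps lmod_hom_def PiE_def)
  show "\<phi> X = \<psi> X" if "X \<in> carrier (quot_mod q)" for X
    using that assms(3) by (auto simp only: carrier_quot_mod)
qed

text \<open>Schur's lemma for a module that need not be simple: \<open>q * t \<in> L q\<close> lets
  \<open>q\<close> play the role of \<open>f\<close> in \<open>atom_colon\<close>, so the
  annihilator of t + Rq is Rp for an atom p. It contains q, hence Rp = Rq and t acts
  bijectively.\<close>

lemma C_ring_nonzero:
  fixes q :: "'a::two_fir"
  assumes q: "q \<in> atoms" and \<phi>: "\<phi> \<in> carrier (C_ring q)" "\<phi> \<noteq> \<zero>\<^bsub>C_ring q\<^esub>"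
  obtains t where "rmult_iso q q t" "\<phi> = rmult_hom q q t"
proof -
  interpret C: ring "C_ring q" by (rule C_ring_ring)
  obtain t where t: "q * t \<in> L q" "\<phi> = rmult_hom q q t"
    using lmod_hom_quot_modE \<phi>(1) by (metis C_ring_simps(1))
  have "t \<notin> L q"
  proof
    assume "t \<in> L q"
    then have "\<phi> = \<zero>\<^bsub>C_ring q\<^esub>"
      using \<phi>(1) C.zero_closed
      by (intro C_ring_eqI[of _ q]) (simp_all add: t(2) rmult_hom_coset[OF t(1)] C_ring_simps(4)
          coset_eq_zero_iff L_mult_left)
    with \<phi>(2) show False by contradiction
  qed
  then obtain p where p: "p \<in> atoms" "rmult_iso p q t"
    using atom_colon[OF atoms_nonzero[OF q] t(1) q] by metis
  then have "q \<in> L p" using t(1) rmult_iso_D by blast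
  then have "L q = L p" using atom_L_subset[OF q] atoms_nonunit[OF p(1)] by blast
  then have "rmult_iso q q (1 * t)" using rmult_iso_trans[OF rmult_iso_L_cong p(2)] by blast
  then show thesis using that t by simp
qed

lemma skew_field_C_ring:
  fixes q :: "'a::two_fir"
  assumes q: "q \<in> atoms"
  shows "skew_field (C_ring q)"
proof -
  interpret C: ring "C_ring q" by (rule C_ring_ring)
  have "1 \<notin> L q" using atoms_nonunit[OF q] by (simp add: ring_units_iff)
  then have "\<one>\<^bsub>C_ring q\<^esub> (1 +o L q) \<noteq> \<zero>\<^bsub>C_ring q\<^esub> (1 +o L q)"
    by (simp add: C_ring_simps coset_eq_zero_iff)
  then have one: "\<one>\<^bsub>C_ring q\<^esub> \<noteq> \<zero>\<^bsub>C_ring q\<^esub>" by metis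
  have "\<phi> \<in> Units (C_ring q)" if \<phi>: "\<phi> \<in> carrier (C_ring q)" "\<phi> \<noteq> \<zero>\<^bsub>C_ring q\<^esub>" for \<phi>
  proof -
    obtain t where t: "rmult_iso q q t" "\<phi> = rmult_hom q q t" using C_ring_nonzero[OF q \<phi>] by metis
    obtain s where s: "rmult_iso q q s" "s * t - 1 \<in> L q" "t * s - 1 \<in> L q"
      using rmult_iso_inverse[OF t(1)] by metis
    have mem: "q * t \<in> L q" "q * s \<in> L q"
      using t(1) s(1) L_self rmult_iso_D by blast+
    let ?\<psi> = "rmult_hom q q s"
    have \<psi>: "?\<psi> \<in> carrier (C_ring q)" using rmult_hom_in_lmod_hom[OF mem(2)] by (simp add: C_ring_simps)
    have inverse: "(x * a) * b - x \<in> L q" if "a * b - 1 \<in> L q" for x a b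
      using L_mult_left[OF that, of x] by (simp add: algebra_simps)
    have "\<phi> \<otimes>\<^bsub>C_ring q\<^esub> ?\<psi> = \<one>\<^bsub>C_ring q\<^esub>"
      using \<phi>(1) \<psi> s(3)
      by (intro C_ring_eqI[of _ q])
         (simp_all add: C_ring_simps(2,3) rmult_hom_coset[OF mem(1)] rmult_hom_coset[OF mem(2)] t(2)
           coset_eq_iff inverse)
    moreover have "?\<psi> \<otimes>\<^bsub>C_ring q\<^esub> \<phi> = \<one>\<^bsub>C_ring q\<^esub>"
      using \<phi>(1) \<psi> s(2)
      by (intro C_ring_eqI[of _ q])
         (simp_all add: C_ring_simps(2,3) rmult_hom_coset[OF mem(1)] rmult_hom_coset[OF mem(2)] t(2)
           coset_eq_iff inverse)
    ultimately show ?thesis using \<phi>(1) \<psi> by (auto simp: Units_def)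
  qed
  moreover have "\<zero>\<^bsub>C_ring q\<^esub> \<notin> Units (C_ring q)"
  proof
    assume "\<zero>\<^bsub>C_ring q\<^esub> \<in> Units (C_ring q)"
    then obtain \<psi> where "\<psi> \<in> carrier (C_ring q)" "\<psi> \<otimes>\<^bsub>C_ring q\<^esub> \<zero>\<^bsub>C_ring q\<^esub> = \<one>\<^bsub>C_ring q\<^esub>"
      by (auto simp: Units_def)
    then show False using one by simp
  qed
  ultimately show ?thesis
    unfolding skew_field_def using C.ring_axioms one C.Units_closed by blast
qed

section \<open>Direct sums\<close>

text \<open>The components of the image of the coset of 1 are vectors in the R/Rp_i, and injectivity
  makes Rf the intersection of their annihilators. By \<open>atom_colon\<close> each annihilator is
  R or Rp for some p in V(f).\<close>

lemma fully_reducible_if_embeds: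
  fixes f :: "'a::two_fir"
  assumes n: "natoms n f" and ps: "set ps \<subseteq> atoms"
    and iso: "lmod_iso (quot_mod f) (direct_sum (map quot_mod ps))"
  shows "fully_reducible f"
proof -
  let ?S = "direct_sum (map quot_mod ps)"
  have f: "f \<noteq> 0" using n natoms_nonzero by blast
  obtain h where h: "h \<in> lmod_hom (quot_mod f) ?S" "bij_betw h (carrier (quot_mod f)) (carrier ?S)"
    using iso by (auto simp: lmod_iso_def)
  have "h (1 +o L f) \<in> carrier ?S" using h(1) by (auto simp: lmod_hom_def)
  then have "\<forall>i<length ps. \<exists>x. h (1 +o L f) i = x +o L (ps ! i)"
    by (auto simp: direct_sum_def carrier_quot_mod PiE_iff)
  then obtain x where x: "\<And>i. i < length ps \<Longrightarrow> h (1 +o L f) i = x i +o L (ps ! i)" by metis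
  have hr: "h (r +o L f) i = (r * x i) +o L (ps ! i)" if "i < length ps" for r i
  proof -
    have "h (r \<odot>\<^bsub>quot_mod f\<^esub> (1 +o L f)) = r \<odot>\<^bsub>?S\<^esub> h (1 +o L f)"
      using h(1) by (simp add: lmod_hom_def)
    then show ?thesis using that x by (simp add: quot_smult direct_sum_def)
  qed
  have mem: "r \<in> L f \<longleftrightarrow> (\<forall>i<length ps. r * x i \<in> L (ps ! i))" for r
  proof -
    have "r \<in> L f \<longleftrightarrow> r +o L f = 0 +o L f" unfolding coset_eq_iff by simp
    also have "\<dots> \<longleftrightarrow> h (r +o L f) = h (0 +o L f)"
      using h(2) by (intro inj_on_eq_iff[of _ "carrier (quot_mod f)", symmetric])
        (auto simp: bij_betw_def simp del: set_zero_plus)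
    also have "\<dots> \<longleftrightarrow> (\<forall>i<length ps. h (r +o L f) i = h (0 +o L f) i)"
    proof -
      have ext: "h (y +o L f) \<in> extensional {..<length ps}" for y
      proof -
        have "h (y +o L f) \<in> carrier ?S"
          using h(1) coset_in_carrier[of y f] unfolding lmod_hom_def by (metis (no_types, lifting) CollectD PiE_mem)
        then show ?thesis by (auto simp: direct_sum_def PiE_def)
      qed
      show ?thesis using extensionalityI[OF ext ext] by (metis lessThan_iff)
    qed
    also have "\<dots> \<longleftrightarrow> (\<forall>i<length ps. r * x i \<in> L (ps ! i))"
      by (simp add: hr coset_eq_iff del: set_zero_plus)
    finally show ?thesis .
  qed
  have "z \<in> L f" if z: "z \<in> (\<Inter>p\<in>V_atoms f. L p)" for z
    unfolding mem
  proof (intro allI impI)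
    fix i assume i: "i < length ps"
    have fx: "f * x i \<in> L (ps ! i)" using mem[of f] i by simp
    show "z * x i \<in> L (ps ! i)"
    proof (cases "x i \<in> L (ps ! i)")
      case False
      then obtain p where p: "p \<in> atoms" "rmult_iso p (ps ! i) (x i)"
        using atom_colon[OF f fx] i ps by (metis nth_mem subsetD)
      then have "p \<in> V_atoms f" using fx rmult_iso_D[OF p(2)] by (simp add: V_atoms_iff)
      then show ?thesis using z rmult_iso_D[OF p(2)] by blast
    qed (rule L_mult_left)
  qed
  then have "L f = (\<Inter>p\<in>V_atoms f. L p)" by (auto simp: L_eq_Inter_iff V_atoms_iff)
  then show ?thesis using fully_reducible_iff_V_atoms[OF n] by blast
qed

lemma independent_atoms_CRT:
  fixes m :: "'a::two_fir"
  assumes "independent_atoms B m"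
  shows "\<exists>z. \<forall>p\<in>B. z - c p \<in> L p"
proof -
  have "finite B" using assms by (simp add: independent_atoms_def)
  then show ?thesis using assms
  proof (induction B arbitrary: m rule: finite_induct)
    case (insert p B)
    obtain m' where m': "independent_atoms B m'" "m' \<notin> L p"
      using independent_atoms_remove[OF insert.prems insert.hyps(2)] by metis
    obtain x where x: "\<forall>p\<in>B. x - c p \<in> L p" using insert.IH[OF m'(1)] by blast
    have m: "L m = L p \<inter> L m'" "m \<noteq> 0" "p \<in> atoms"
      using insert.prems m' natoms_nonzero by (auto simp: independent_atoms_def)
    then have "m \<in> L p \<inter> L m'" using L_self by blast
    then obtain u v where uv: "u * m' + v * p = 1"
      using coprime_atom[OF m(2) _ _ m(3) m'(2)] by blast
    \<comment> \<open>The correction is a multiple of \<open>m'\<close>, so it keeps the congruences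
      over \<open>B\<close>; modulo Rp it equals \<open>c p - x\<close> by the Bezout
      relation.\<close>
    define z where "z = x + ((c p - x) * u) * m'"
    have "z - c p = - ((c p - x) * v) * p"
      using arg_cong[OF uv, of "\<lambda>z. (c p - x) * z"] by (simp add: z_def algebra_simps)
    then have "z - c p \<in> L p" by (metis L_multI)
    moreover have "z - c p' \<in> L p'" if "p' \<in> B" for p'
    proof -
      have "m' \<in> L p'" using m'(1) that L_self[of m'] by (auto simp: independent_atoms_def)
      then have "(x - c p') + ((c p - x) * u) * m' \<in> L p'" using x that L_add L_mult_left by blast
      then show ?thesis by (simp add: z_def algebra_simps)
    qed
    ultimately show ?case by blast
  qed simp
qed

lemma coset_plus_L:
  assumes "f \<in> L p"
  shows "(x +o L f) + L p = x +o L p"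
proof -
  have "L f + L p = L p"
  proof
    show "L f + L p \<subseteq> L p" using assms by (auto elim!: set_plus_elim intro: L_add L_trans)
    show "L p \<subseteq> L f + L p" using set_zero_plus2[OF L_zero] .
  qed
  then show ?thesis by (simp add: set_plus_rearrange3)
qed

text \<open>The summands come from an independent subset of V(f), for which
  \<open>independent_atoms_CRT\<close> makes the diagonal map onto; an arbitrary list of atoms with
  intersection Rf could be redundant.\<close>

lemma fully_reducible_direct_sum:
  fixes f :: "'a::two_fir"
  assumes f: "fully_reducible f"
  obtains ps where "set ps \<subseteq> atoms" "lmod_iso (quot_mod f) (direct_sum (map quot_mod ps))"
proof -
  obtain n where n: "natoms n f" using f fully_reducible_natoms by blast
  obtain B m where B: "B \<subseteq> V_atoms f" "independent_atoms B m" "L m = (\<Inter>p\<in>V_atoms f. L p)"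
    using independent_V_atoms[OF n] by metis
  then have Lf: "L f = (\<Inter>p\<in>B. L p)"
    using fully_reducible_iff_V_atoms[OF n] f by (simp add: independent_atoms_def)
  obtain ps where ps: "set ps = B" "distinct ps"
    using B(2) finite_distinct_list unfolding independent_atoms_def by metis
  have fp: "f \<in> L (ps ! i)" if "i < length ps" for i
    using Lf ps that L_self[of f] nth_mem by blast
  let ?S = "direct_sum (map quot_mod ps)"
  define h where "h = (\<lambda>X\<in>carrier (quot_mod f). \<lambda>i\<in>{..<length ps}. X + L (ps ! i))"
  have h: "h (x +o L f) = (\<lambda>i\<in>{..<length ps}. x +o L (ps ! i))" for x
    unfolding h_def using fp by (simp add: coset_plus_L cong: restrict_cong)
  have carrier_S: "u \<in> carrier ?S \<longleftrightarrow> (\<exists>x. u = (\<lambda>i\<in>{..<length ps}. x i +o L (ps ! i)))" for u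
  proof
    assume u: "u \<in> carrier ?S"
    then have "\<forall>i<length ps. \<exists>x. u i = x +o L (ps ! i)"
      by (auto simp: direct_sum_def carrier_quot_mod PiE_iff)
    then obtain x where "\<And>i. i < length ps \<Longrightarrow> u i = x i +o L (ps ! i)" by metis
    moreover have "u \<in> extensional {..<length ps}" using u by (auto simp: direct_sum_def PiE_def)
    ultimately have "u = (\<lambda>i\<in>{..<length ps}. x i +o L (ps ! i))"
      by (intro extensionalityI[of _ "{..<length ps}"]) auto
    then show "\<exists>x. u = (\<lambda>i\<in>{..<length ps}. x i +o L (ps ! i))" by blast
  qed (auto simp: direct_sum_def)
  have "h \<in> lmod_hom (quot_mod f) ?S"
    unfolding lmod_hom_def
  proof (intro CollectI conjI ballI allI)
    show "h \<in> carrier (quot_mod f) \<rightarrow>\<^sub>E carrier ?S"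
    proof (rule PiE_I)
      fix X assume "X \<in> carrier (quot_mod f)"
      then show "h X \<in> carrier ?S" unfolding carrier_S by (auto simp: carrier_quot_mod h)
    qed (simp add: h_def)
    fix X assume "X \<in> carrier (quot_mod f)"
    then obtain x where x: "X = x +o L f" by (auto simp: carrier_quot_mod)
    show "h (r \<odot>\<^bsub>quot_mod f\<^esub> X) = r \<odot>\<^bsub>?S\<^esub> h X" for r
      by (rule ext) (simp add: x quot_smult h direct_sum_def)
    fix Y assume "Y \<in> carrier (quot_mod f)"
    then obtain y where y: "Y = y +o L f" by (auto simp: carrier_quot_mod)
    show "h (X \<oplus>\<^bsub>quot_mod f\<^esub> Y) = h X \<oplus>\<^bsub>?S\<^esub> h Y"
      by (rule ext) (simp add: x y quot_add h direct_sum_def)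
  qed
  moreover have "bij_betw h (carrier (quot_mod f)) (carrier ?S)"
    unfolding bij_betw_def
  proof
    show "inj_on h (carrier (quot_mod f))"
    proof (rule inj_onI)
      fix X Y assume "X \<in> carrier (quot_mod f)" "Y \<in> carrier (quot_mod f)" and eq: "h X = h Y"
      then obtain x y where xy: "X = x +o L f" "Y = y +o L f" by (auto simp: carrier_quot_mod)
      have "x - y \<in> L p" if "p \<in> B" for p
      proof -
        obtain i where i: "i < length ps" "p = ps ! i" using ps(1) \<open>p \<in> B\<close> by (metis in_set_conv_nth)
        have "h X i = h Y i" using eq by simp
        then show ?thesis using i by (simp add: xy h coset_eq_iff)
      qed
      then have "x - y \<in> L f" unfolding Lf by blast
      then show "X = Y" unfolding xy coset_eq_iff .
    qed
    show "h ` carrier (quot_mod f) = carrier ?S"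
    proof (intro equalityI subsetI)
      fix u assume "u \<in> carrier ?S"
      then obtain x where x: "u = (\<lambda>i\<in>{..<length ps}. x i +o L (ps ! i))" using carrier_S by blast
      \<comment> \<open>Residues are prescribed by position, while
        \<open>independent_atoms_CRT\<close> expects them by atom; \<open>ps\<close> is distinct, so
        each atom has one position.\<close>
      define c where "c p = x (THE i. i < length ps \<and> ps ! i = p)" for p
      have c: "c (ps ! i) = x i" if "i < length ps" for i
      proof -
        have "(THE j. j < length ps \<and> ps ! j = ps ! i) = i"
          using that ps(2) nth_eq_iff_index_eq by (intro the_equality) auto
        then show ?thesis by (simp add: c_def)
      qed
      obtain z where z: "\<forall>p\<in>B. z - c p \<in> L p" using independent_atoms_CRT[OF B(2)] by blast
      have "z +o L (ps ! i) = x i +o L (ps ! i)" if "i < length ps" for i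
      proof -
        have "ps ! i \<in> B" using ps that by auto
        then show ?thesis unfolding coset_eq_iff using z c[OF that] by force
      qed
      then have "u = h (z +o L f)" unfolding h x by (intro restrict_ext) auto
      then show "u \<in> h ` carrier (quot_mod f)" by simp
    next
      fix u assume "u \<in> h ` carrier (quot_mod f)"
      then show "u \<in> carrier ?S" unfolding carrier_S by (auto simp: carrier_quot_mod h)
    qed
  qed
  ultimately have "lmod_iso (quot_mod f) ?S" unfolding lmod_iso_def by blast
  moreover have "set ps \<subseteq> atoms" using ps B(2) by (simp add: independent_atoms_def)
  ultimately show thesis using that by blast
qed

section \<open>Kernels and dimensions\<close>

lemma similar_sym: "similar a b \<Longrightarrow> similar b a"
  unfolding similar_iff using rmult_iso_inverse by metis

lemma similar_trans: "similar a b \<Longrightarrow> similar b c \<Longrightarrow> similar a c"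
  unfolding similar_iff using rmult_iso_trans by blast

lemma similar_refl: "a \<noteq> 0 \<Longrightarrow> similar a a"
  unfolding similar_iff using rmult_iso_L_cong by blast

lemma rmult_iso_similar:
  "rmult_iso p q t \<Longrightarrow> p \<in> atoms \<Longrightarrow> q \<in> atoms \<Longrightarrow> similar p q"
  using atoms_nonzero by (auto simp: similar_iff)

lemma L_mult_right: "x \<in> L a \<Longrightarrow> a * t \<in> L b \<Longrightarrow> x * t \<in> L b"
  using L_mult_left[of "a * t" b] by (auto simp: mem_L_iff[of x] mult.assoc)

definition kills :: "'a::ring_1 \<Rightarrow> 'a \<Rightarrow> 'a set \<Rightarrow> bool" where
  "kills q r X \<longleftrightarrow> r \<odot>\<^bsub>quot_mod q\<^esub> X = \<zero>\<^bsub>quot_mod q\<^esub>"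

lemma kills_coset: "kills q r (x +o L q) \<longleftrightarrow> r * x \<in> L q"
  by (simp add: kills_def quot_smult coset_eq_zero_iff)

lemma kills_zero: "kills q r \<zero>\<^bsub>quot_mod q\<^esub>"
  using kills_coset[of q r 0] by (simp add: zero_quot_mod)

section \<open>The kernel as a right vector space over C(q)\<close>

context
  fixes f q :: "'a::two_fir"
  assumes f: "f \<noteq> 0" and q: "q \<in> atoms"
begin

private abbreviation (input) K where "K \<equiv> ker_lambda f q"
private abbreviation (input) D where "D \<equiv> C_ring q"

lemma coset_in_ker: "x +o L q \<in> carrier K \<longleftrightarrow> f * x \<in> L q"
  by (auto simp: ker_lambda_def carrier_quot_mod lambda_map_coset coset_eq_zero_iff)

lemma carrier_ker: "X \<in> carrier K \<longleftrightarrow> (\<exists>x. X = x +o L q \<and> f * x \<in> L q)"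
proof
  assume X: "X \<in> carrier K"
  then obtain x where "X = x +o L q" by (auto simp: ker_lambda_def carrier_quot_mod)
  with X show "\<exists>x. X = x +o L q \<and> f * x \<in> L q" using coset_in_ker by blast
qed (use coset_in_ker in blast)

lemma carrier_kerE:
  assumes "X \<in> carrier K"
  obtains x where "X = x +o L q" "f * x \<in> L q"
  using assms carrier_ker by blast

lemma ker_simps: "X \<oplus>\<^bsub>K\<^esub> Y = X \<oplus>\<^bsub>quot_mod q\<^esub> Y" "\<zero>\<^bsub>K\<^esub> = \<zero>\<^bsub>quot_mod q\<^esub>" "\<phi> \<odot>\<^bsub>K\<^esub> X = \<phi> X"
  by (simp_all add: ker_lambda_def)

lemma ker_abelian_group: "abelian_group K"
proof (rule abelian_groupI)
  fix X assume "X \<in> carrier K"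
  then obtain x where x: "X = x +o L q" "f * x \<in> L q" by (rule carrier_kerE)
  then have "(- x) +o L q \<in> carrier K" by (simp add: coset_in_ker L_minus)
  moreover have "((- x) +o L q) \<oplus>\<^bsub>K\<^esub> X = \<zero>\<^bsub>K\<^esub>"
    by (simp only: x ker_simps quot_add coset_eq_zero_iff add.left_inverse L_zero)
  ultimately show "\<exists>Y\<in>carrier K. Y \<oplus>\<^bsub>K\<^esub> X = \<zero>\<^bsub>K\<^esub>" by blast
  show "\<zero>\<^bsub>K\<^esub> \<oplus>\<^bsub>K\<^esub> X = X" by (simp add: x ker_simps zero_quot_mod quot_add del: set_zero_plus)
  fix Y assume "Y \<in> carrier K"
  then obtain y where y: "Y = y +o L q" "f * y \<in> L q" by (rule carrier_kerE)
  show "X \<oplus>\<^bsub>K\<^esub> Y \<in> carrier K"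
    using x y by (simp add: ker_simps quot_add coset_in_ker distrib_left L_add)
  show "X \<oplus>\<^bsub>K\<^esub> Y = Y \<oplus>\<^bsub>K\<^esub> X" by (simp add: x y ker_simps quot_add add.commute)
  fix Z assume "Z \<in> carrier K"
  then obtain z where z: "Z = z +o L q" "f * z \<in> L q" by (rule carrier_kerE)
  show "X \<oplus>\<^bsub>K\<^esub> Y \<oplus>\<^bsub>K\<^esub> Z = X \<oplus>\<^bsub>K\<^esub> (Y \<oplus>\<^bsub>K\<^esub> Z)"
    by (simp add: x y z ker_simps quot_add add.assoc)
next
  show "\<zero>\<^bsub>K\<^esub> \<in> carrier K" by (simp add: ker_simps zero_quot_mod coset_in_ker del: set_zero_plus)
qed

interpretation K: abelian_group K by (rule ker_abelian_group)
interpretation D: ring D by (rule C_ring_ring)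

lemma carrier_DE:
  assumes "c \<in> carrier D"
  obtains t where "q * t \<in> L q" "c = rmult_hom q q t"
  using assms lmod_hom_quot_modE by (metis C_ring_simps(1))

lemma D_app_closed:
  assumes "c \<in> carrier D" "X \<in> carrier K"
  shows "c X \<in> carrier K"
proof -
  obtain t where t: "q * t \<in> L q" "c = rmult_hom q q t" using assms(1) by (rule carrier_DE)
  obtain x where x: "X = x +o L q" "f * x \<in> L q" using assms(2) by (rule carrier_kerE)
  have "f * (x * t) \<in> L q" using L_mult_right[OF x(2) t(1)] by (simp add: mult.assoc)
  then show ?thesis by (simp add: t(2) x(1) rmult_hom_coset[OF t(1)] coset_in_ker)
qed

text \<open>Endomorphisms commute with the scalar \<open>r\<close>; this is what extends
  annihilation from a set to its span in \<open>kills_comb\<close>.\<close>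

lemma kills_D_app:
  assumes "c \<in> carrier D" "X \<in> carrier K" "kills q r X"
  shows "kills q r (c X)"
proof -
  obtain t where t: "q * t \<in> L q" "c = rmult_hom q q t" using assms(1) by (rule carrier_DE)
  obtain x where x: "X = x +o L q" "f * x \<in> L q" using assms(2) by (rule carrier_kerE)
  have "r * x \<in> L q" using assms(3) by (simp add: x kills_coset)
  then have "r * (x * t) \<in> L q" using L_mult_right[OF _ t(1)] by (metis mult.assoc)
  then show ?thesis by (simp add: t(2) x(1) rmult_hom_coset[OF t(1)] kills_coset)
qed

lemma kills_add:
  assumes "X \<in> carrier K" "Y \<in> carrier K" "kills q r X"
  shows "kills q r (X \<oplus>\<^bsub>K\<^esub> Y) \<longleftrightarrow> kills q r Y"
  using assms by (auto elim!: carrier_kerE simp: ker_simps quot_add kills_coset distrib_left L_add_cancel)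

lemma comb_closed:
  assumes "A \<subseteq> carrier K" "c \<in> A \<rightarrow> carrier D"
  shows "(\<lambda>v. c v \<odot>\<^bsub>K\<^esub> v) \<in> A \<rightarrow> carrier K"
  using assms D_app_closed by (auto simp: ker_simps)

lemma kills_comb:
  assumes "finite A" "A \<subseteq> carrier K" "c \<in> A \<rightarrow> carrier D" "\<And>v. v \<in> A \<Longrightarrow> kills q r v"
  shows "kills q r (\<Oplus>\<^bsub>K\<^esub>v\<in>A. c v \<odot>\<^bsub>K\<^esub> v)"
  using assms
proof (induction A rule: finite_induct)
  case empty
  show ?case by (simp add: ker_simps kills_zero)
next
  case (insert v A)
  have cl: "(\<lambda>v. c v \<odot>\<^bsub>K\<^esub> v) \<in> A \<rightarrow> carrier K" "c v \<odot>\<^bsub>K\<^esub> v \<in> carrier K"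
    using comb_closed[OF insert.prems(1,2)] by auto
  have "kills q r (c v \<odot>\<^bsub>K\<^esub> v)" using insert.prems kills_D_app by (simp add: ker_simps)
  moreover have "kills q r (\<Oplus>\<^bsub>K\<^esub>v\<in>A. c v \<odot>\<^bsub>K\<^esub> v)" using insert by auto
  ultimately show ?case
    using kills_add[OF cl(2) K.finsum_closed[OF cl(1)]] insert.hyps cl by simp
qed

lemma comb_insert:
  assumes "finite A" "insert X A \<subseteq> carrier K" "X \<notin> A" "c \<in> A \<rightarrow> carrier D" "d \<in> carrier D"
  shows "(\<Oplus>\<^bsub>K\<^esub>v\<in>insert X A. (c(X := d)) v \<odot>\<^bsub>K\<^esub> v) = d X \<oplus>\<^bsub>K\<^esub> (\<Oplus>\<^bsub>K\<^esub>v\<in>A. c v \<odot>\<^bsub>K\<^esub> v)"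
proof -
  have cl: "(\<lambda>v. c v \<odot>\<^bsub>K\<^esub> v) \<in> A \<rightarrow> carrier K" using comb_closed assms by auto
  have "(\<Oplus>\<^bsub>K\<^esub>v\<in>A. (c(X := d)) v \<odot>\<^bsub>K\<^esub> v) = (\<Oplus>\<^bsub>K\<^esub>v\<in>A. c v \<odot>\<^bsub>K\<^esub> v)"
    by (rule K.finsum_cong') (use assms cl in auto)
  moreover have "(\<Oplus>\<^bsub>K\<^esub>v\<in>insert X A. (c(X := d)) v \<odot>\<^bsub>K\<^esub> v) =
      (c(X := d)) X \<odot>\<^bsub>K\<^esub> X \<oplus>\<^bsub>K\<^esub> (\<Oplus>\<^bsub>K\<^esub>v\<in>A. (c(X := d)) v \<odot>\<^bsub>K\<^esub> v)"
    by (rule K.finsum_insert) (use assms cl D_app_closed in \<open>auto simp: ker_simps\<close>)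
  ultimately show ?thesis by (simp add: ker_simps)
qed

lemma lin_span_insert:
  assumes B: "insert X B \<subseteq> carrier K" "X \<notin> B" and Z: "Z \<in> lin_span D K B" and d: "d \<in> carrier D"
  shows "d X \<oplus>\<^bsub>K\<^esub> Z \<in> lin_span D K (insert X B)"
proof -
  obtain A c where A: "finite A" "A \<subseteq> B" "c \<in> A \<rightarrow> carrier D" "Z = (\<Oplus>\<^bsub>K\<^esub>v\<in>A. c v \<odot>\<^bsub>K\<^esub> v)"
    using Z by (auto simp: lin_span_def)
  have "insert X A \<subseteq> carrier K" "X \<notin> A" using A B by auto
  from comb_insert[OF A(1) this A(3) d]
  have "d X \<oplus>\<^bsub>K\<^esub> Z = (\<Oplus>\<^bsub>K\<^esub>v\<in>insert X A. (c(X := d)) v \<odot>\<^bsub>K\<^esub> v)" using A(4) by simp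
  moreover have "c(X := d) \<in> insert X A \<rightarrow> carrier D" using A(3) d by auto
  ultimately show ?thesis
    unfolding lin_span_def using A(1,2) by (intro CollectI exI[of _ "insert X A"] exI[of _ "c(X := d)"]) auto
qed

lemma lin_indep_notin_span:
  assumes ind: "lin_indep D K (insert X B)" and B: "insert X B \<subseteq> carrier K" "X \<notin> B"
  shows "X \<notin> lin_span D K B"
proof
  assume "X \<in> lin_span D K B"
  then obtain A c where A: "finite A" "A \<subseteq> B" "c \<in> A \<rightarrow> carrier D" "X = (\<Oplus>\<^bsub>K\<^esub>v\<in>A. c v \<odot>\<^bsub>K\<^esub> v)"
    by (auto simp: lin_span_def)
  \<comment> \<open>Moving \<open>X\<close> to the other side gives a relation in which it has
    coefficient -1.\<close>
  let ?d = "\<ominus>\<^bsub>D\<^esub> \<one>\<^bsub>D\<^esub>"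
  have XQ: "X \<in> carrier (quot_mod q)" using B by (auto elim: carrier_kerE)
  have "(?d \<oplus>\<^bsub>D\<^esub> \<one>\<^bsub>D\<^esub>) X = ?d X \<oplus>\<^bsub>quot_mod q\<^esub> \<one>\<^bsub>D\<^esub> X"
    using XQ by (simp add: C_ring_def lmod_End_def)
  moreover have "?d \<oplus>\<^bsub>D\<^esub> \<one>\<^bsub>D\<^esub> = \<zero>\<^bsub>D\<^esub>" by (rule D.l_neg) simp
  ultimately have d: "?d X \<oplus>\<^bsub>K\<^esub> X = \<zero>\<^bsub>K\<^esub>" using XQ by (simp add: ker_simps C_ring_simps)
  have XA: "insert X A \<subseteq> carrier K" "X \<notin> A" using A B by auto
  from comb_insert[OF A(1) XA A(3), of ?d]
  have "(\<Oplus>\<^bsub>K\<^esub>v\<in>insert X A. (c(X := ?d)) v \<odot>\<^bsub>K\<^esub> v) = \<zero>\<^bsub>K\<^esub>" using d A(4) by simp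
  moreover have "finite (insert X A)" "insert X A \<subseteq> insert X B"
    "c(X := ?d) \<in> insert X A \<rightarrow> carrier D"
    using A by auto
  ultimately have "(c(X := ?d)) X = \<zero>\<^bsub>D\<^esub>"
    using ind unfolding lin_indep_def by blast
  then have "?d = \<zero>\<^bsub>D\<^esub>" by simp
  then have "\<one>\<^bsub>D\<^esub> = \<zero>\<^bsub>D\<^esub>" using D.minus_minus[OF D.one_closed] by simp
  then show False using skew_field_C_ring[OF q] by (simp add: skew_field_def)
qed

lemma lin_indep_subset: "lin_indep D K B \<Longrightarrow> A \<subseteq> B \<Longrightarrow> lin_indep D K A"
  unfolding lin_indep_def by (meson subset_trans)

text \<open>The last conjunct is a double annihilator (density) property. In the induction step, \<open>m x + Rq\<close> is nonzero for a generator \<open>m\<close> of the annihilator of the smaller set,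
  and \<open>a\<close> is chosen such that \<open>m x a \<equiv> m y\<close>, so that the induction hypothesis applies to \<open>y - x a\<close>.\<close>

lemma lin_indep_annihilator:
  assumes "finite B" "B \<subseteq> carrier K" "lin_indep D K B"
  shows "\<exists>m P. finite P \<and> P \<subseteq> atoms \<and> (\<forall>p\<in>P. similar p q) \<and> L m = (\<Inter>p\<in>P. L p) \<and>
    natoms (card B) m \<and> (\<forall>r. r \<in> L m \<longleftrightarrow> (\<forall>X\<in>B. kills q r X)) \<and>
    (\<forall>Y\<in>carrier K. kills q m Y \<longrightarrow> Y \<in> lin_span D K B)"
  using assms
proof (induction B rule: finite_induct)
  case empty
  have "Y \<in> lin_span D K {}" if Y: "Y \<in> carrier K" "kills q 1 Y" for Y
  proof -
    obtain y where y: "Y = y +o L q" using Y(1) by (rule carrier_kerE)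
    then have "y \<in> L q" using Y(2) by (simp add: kills_coset)
    then have "Y = \<zero>\<^bsub>K\<^esub>" unfolding y ker_simps by (simp only: coset_eq_zero_iff)
    then show ?thesis by (simp add: lin_span_def)
  qed
  then show ?case by (intro exI[of _ 1] exI[of _ "{}"]) simp
next
  case (insert X B)
  have "lin_indep D K B" using lin_indep_subset insert.prems(2) by blast
  then obtain m P where P: "finite P" "P \<subseteq> atoms" "\<forall>p\<in>P. similar p q" "L m = (\<Inter>p\<in>P. L p)"
    and m: "natoms (card B) m" "\<And>r. r \<in> L m \<longleftrightarrow> (\<forall>X\<in>B. kills q r X)"
      "\<And>Y. Y \<in> carrier K \<Longrightarrow> kills q m Y \<Longrightarrow> Y \<in> lin_span D K B"
    using insert by (metis insert_subset)
  obtain x where x: "X = x +o L q" "f * x \<in> L q" using insert.prems(1) carrier_kerE by blast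
  have "X \<notin> lin_span D K B" using lin_indep_notin_span insert by blast
  then have "\<not> kills q m X" using m(3) insert.prems(1) by blast
  then have mx: "m * x \<notin> L q" by (simp add: x(1) kills_coset)
  then have "x \<notin> L q" using L_mult_left by blast
  \<comment> \<open>Rp is the annihilator of \<open>X\<close>; intersecting Rm with it adds one atom
    because \<open>m\<close> does not kill \<open>X\<close>.\<close>
  then obtain p where p: "p \<in> atoms" "rmult_iso p q x"
    using atom_colon[OF f x(2) q] by metis
  have fm: "f \<in> L m"
    unfolding m(2) using insert.prems(1) by (auto elim!: carrier_kerE simp: kills_coset)
  have fp: "f \<in> L p" "m \<notin> L p" using x(2) mx rmult_iso_D[OF p(2)] by blast+
  obtain p' where p': "p' \<in> atoms" "rmult_iso p' p m" "L (p' * m) = L m \<inter> L p"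
    "natoms (Suc (card B)) (p' * m)"
    using L_Int_atom[OF m(1) p(1) f fm fp] by metis
  have iso: "rmult_iso p' q (m * x)" using rmult_iso_trans[OF p'(2) p(2)] .
  obtain s where s: "rmult_iso q p' s" "s * (m * x) - 1 \<in> L q" "m * x * s - 1 \<in> L p'"
    using rmult_iso_inverse[OF iso] by metis
  have "Y \<in> lin_span D K (insert X B)" if Y: "Y \<in> carrier K" "kills q (p' * m) Y" for Y
  proof -
    obtain y where y: "Y = y +o L q" "f * y \<in> L q" using Y(1) by (rule carrier_kerE)
    have pmy: "p' * (m * y) \<in> L q" using Y(2) by (simp add: y kills_coset mult.assoc)
    have to_q: "z * (m * y) \<in> L q" if "z \<in> L p'" for z
      using L_mult_right[OF that pmy] .
    \<comment> \<open>\<open>s\<close> inverts right multiplication by \<open>m * x\<close> from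
      R/Rp' to R/Rq, and \<open>m * y\<close> also induces a map from R/Rp' to R/Rq since
      \<open>p'\<close> kills its coset. So \<open>a\<close> induces an endomorphism of R/Rq that
      carries the coset of \<open>m * x\<close> to that of \<open>m * y\<close>.\<close>
    define a where "a = s * (m * y)"
    have "q * s \<in> L p'" using rmult_iso_D[OF s(1)] by simp
    then have qa: "q * a \<in> L q" using to_q[of "q * s"] by (simp add: a_def mult.assoc)
    have "(m * x * s - 1) * (m * y) \<in> L q" using to_q s(3) by blast
    then have "m * (x * a) - m * y \<in> L q" by (simp add: a_def algebra_simps)
    then have mz: "m * (y - x * a) \<in> L q"
      using L_diff_commute[of "m * y"] by (simp add: right_diff_distrib)
    have "f * (x * a) \<in> L q" using L_mult_right[OF x(2) qa] by (simp add: mult.assoc)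
    then have fz: "f * (y - x * a) \<in> L q" using y(2) by (simp add: right_diff_distrib L_diff)
    have "(y - x * a) +o L q \<in> lin_span D K B"
      using m(3) fz mz by (simp add: coset_in_ker kills_coset)
    moreover have "rmult_hom q q a \<in> carrier D"
      using rmult_hom_in_lmod_hom[OF qa] by (simp add: C_ring_simps)
    ultimately have "rmult_hom q q a X \<oplus>\<^bsub>K\<^esub> ((y - x * a) +o L q) \<in> lin_span D K (insert X B)"
      using lin_span_insert insert.prems(1) insert.hyps(2) by blast
    then show ?thesis by (simp add: x y rmult_hom_coset[OF qa] ker_simps quot_add)
  qed
  moreover have "r \<in> L (p' * m) \<longleftrightarrow> (\<forall>X\<in>insert X B. kills q r X)" for r
    using p'(3) m(2) rmult_iso_D[OF p(2), of r] by (auto simp: x(1) kills_coset)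
  moreover have "L (p' * m) = (\<Inter>p\<in>insert p P. L p)" using p'(3) P(4) by auto
  moreover have "similar p q" using rmult_iso_similar p q by blast
  ultimately show ?case
    using P p(1) p'(4) insert.hyps
    by (intro exI[of _ "p' * m"] exI[of _ "insert p P"]) simp
qed

text \<open>\<open>m\<close> kills all combinations of vectors of \<open>B\<close>, so in a relation
  it also kills the term with \<open>Y\<close>. A nonzero coefficient is an automorphism and would
  make \<open>m\<close> kill \<open>Y\<close> itself.\<close>

lemma lin_indep_insert:
  assumes B: "insert Y B \<subseteq> carrier K" "lin_indep D K B"
    and m: "\<And>X. X \<in> B \<Longrightarrow> kills q m X" "\<not> kills q m Y"
  shows "lin_indep D K (insert Y B)"
  unfolding lin_indep_def
proof (intro allI impI, elim conjE)
  fix A c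
  assume A: "finite A" "A \<subseteq> insert Y B" "c \<in> A \<rightarrow> carrier D"
    and sum0: "(\<Oplus>\<^bsub>K\<^esub>v\<in>A. c v \<odot>\<^bsub>K\<^esub> v) = \<zero>\<^bsub>K\<^esub>"
  show "\<forall>v\<in>A. c v = \<zero>\<^bsub>D\<^esub>"
  proof (cases "Y \<in> A")
    case False
    then have "A \<subseteq> B" using A(2) by blast
    then show ?thesis using B(2) A sum0 unfolding lin_indep_def by blast
  next
    case True
    define A' where "A' = A - {Y}"
    have A': "finite A'" "A' \<subseteq> B" "c \<in> A' \<rightarrow> carrier D" "Y \<notin> A'" "insert Y A' = A"
      using A True by (auto simp: A'_def)
    have cY: "c Y \<in> carrier D" "Y \<in> carrier K" using A True B by auto
    have sub: "insert Y A' \<subseteq> carrier K" using A' B by auto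
    have "c Y Y \<oplus>\<^bsub>K\<^esub> (\<Oplus>\<^bsub>K\<^esub>v\<in>A'. c v \<odot>\<^bsub>K\<^esub> v) = \<zero>\<^bsub>K\<^esub>"
      using comb_insert[OF A'(1) sub A'(4,3) cY(1)] sum0 A'(5) by simp
    moreover have cl: "(\<Oplus>\<^bsub>K\<^esub>v\<in>A'. c v \<odot>\<^bsub>K\<^esub> v) \<in> carrier K"
      using comb_closed[of A' c] A' sub by (intro K.finsum_closed) auto
    moreover have "kills q m (\<Oplus>\<^bsub>K\<^esub>v\<in>A'. c v \<odot>\<^bsub>K\<^esub> v)"
      using kills_comb[OF A'(1) _ A'(3)] sub m(1) A'(2) by auto
    moreover have "kills q m \<zero>\<^bsub>K\<^esub>" by (simp add: ker_simps kills_zero)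
    ultimately have kY: "kills q m (c Y Y)"
      using kills_add[OF cl D_app_closed[OF cY]] K.a_comm[OF cl D_app_closed[OF cY]] by simp
    have "c Y = \<zero>\<^bsub>D\<^esub>"
    proof (rule ccontr)
      assume "c Y \<noteq> \<zero>\<^bsub>D\<^esub>"
      then obtain t where t: "rmult_iso q q t" "c Y = rmult_hom q q t"
        using C_ring_nonzero[OF q cY(1)] by metis
      have qt: "q * t \<in> L q" using rmult_iso_D[OF t(1)] by simp
      obtain y where y: "Y = y +o L q" using cY(2) by (rule carrier_kerE)
      have "m * y * t \<in> L q"
        using kY unfolding t(2) unfolding y rmult_hom_coset[OF qt] kills_coset by (simp add: mult.assoc)
      then show False using rmult_iso_D[OF t(1)] m(2) by (simp add: y kills_coset)
    qed
    moreover have "c Y Y = \<zero>\<^bsub>K\<^esub>"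
      using calculation cY(2) by (auto elim!: carrier_kerE simp: C_ring_simps ker_simps)
    then have "(\<Oplus>\<^bsub>K\<^esub>v\<in>A'. c v \<odot>\<^bsub>K\<^esub> v) = \<zero>\<^bsub>K\<^esub>"
      using \<open>c Y Y \<oplus>\<^bsub>K\<^esub> _ = _\<close> cl by simp
    then have "\<forall>v\<in>A'. c v = \<zero>\<^bsub>D\<^esub>" using B(2) A' unfolding lin_indep_def by blast
    ultimately show ?thesis using A'(5) by blast
  qed
qed

text \<open>\<open>f\<close> kills the whole kernel, so the generator of the annihilator of a finite
  independent set is a right factor of \<open>f\<close>, and its length is the size of the
  set.\<close>

lemma lin_indep_bound:
  assumes n: "natoms n f" and B: "B \<subseteq> carrier K" "lin_indep D K B"
  shows "finite B" "card B \<le> n"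
proof -
  have bound: "card A \<le> n" if A: "finite A" "A \<subseteq> B" for A
  proof -
    obtain m where m: "natoms (card A) m" "\<And>r. r \<in> L m \<longleftrightarrow> (\<forall>X\<in>A. kills q r X)"
      using lin_indep_annihilator[OF A(1)] A(2) B lin_indep_subset by (metis order_trans)
    have "f \<in> L m"
      unfolding m(2) using A B by (auto elim!: carrier_kerE dest!: subsetD simp: kills_coset)
    then show ?thesis using natoms_le(1)[OF n] m(1) by blast
  qed
  show fin: "finite B"
  proof (rule ccontr)
    assume "infinite B"
    then obtain A where "A \<subseteq> B" "finite A" "card A = Suc n"
      using infinite_arbitrarily_large by metis
    then show False using bound[of A] by simp
  qed
  show "card B \<le> n" using bound[OF fin] by simp
qed

text \<open>For an independent set of greatest cardinality, a vector killed by \<open>m\<close> is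
  in the span by the double annihilator property, and one not killed would extend the set.\<close>

lemma lin_basis_exists:
  assumes n: "natoms n f"
  shows "\<exists>B. lin_basis D K B"
proof -
  define S where "S k \<longleftrightarrow> (\<exists>B. B \<subseteq> carrier K \<and> lin_indep D K B \<and> card B = k)" for k
  have "S 0" unfolding S_def by (intro exI[of _ "{}"]) (simp add: lin_indep_def)
  moreover have "k \<le> n" if "S k" for k using that lin_indep_bound[OF n] by (auto simp: S_def)
  ultimately obtain k where k: "S k" "\<And>j. S j \<Longrightarrow> j \<le> k"
    by (metis GreatestI_nat Greatest_le_nat)
  then obtain B where B: "B \<subseteq> carrier K" "lin_indep D K B" "card B = k" by (auto simp: S_def)
  have fin: "finite B" using lin_indep_bound[OF n B(1,2)] by blast
  obtain m where m: "\<And>r. r \<in> L m \<longleftrightarrow> (\<forall>X\<in>B. kills q r X)"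
      "\<And>Y. Y \<in> carrier K \<Longrightarrow> kills q m Y \<Longrightarrow> Y \<in> lin_span D K B"
    using lin_indep_annihilator[OF fin B(1,2)] by metis
  have km: "kills q m X" if "X \<in> B" for X using m(1)[of m] that by simp
  have "Y \<in> lin_span D K B" if Y: "Y \<in> carrier K" for Y
  proof (rule ccontr)
    assume "Y \<notin> lin_span D K B"
    then have nk: "\<not> kills q m Y" using m(2) Y by blast
    then have "Y \<notin> B" using km by blast
    moreover have "lin_indep D K (insert Y B)"
      using lin_indep_insert[OF _ B(2) km nk] Y B(1) by blast
    ultimately have "S (Suc k)"
      unfolding S_def using Y B fin by (intro exI[of _ "insert Y B"]) simp
    then show False using k(2) by fastforce
  qed
  moreover have "lin_span D K B \<subseteq> carrier K"
    unfolding lin_span_def using comb_closed B(1) by (auto intro!: K.finsum_closed)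
  ultimately show ?thesis unfolding lin_basis_def using B by blast
qed

text \<open>Whichever basis \<open>vdim\<close> chooses, its annihilator is that of the whole
  kernel; the last conjunct records this without reference to a basis, ready for comparison with
  V(f).\<close>

lemma vdim_ker_lambda:
  assumes n: "natoms n f"
  shows "\<exists>m k P. finite P \<and> P \<subseteq> atoms \<and> (\<forall>p\<in>P. similar p q) \<and> L m = (\<Inter>p\<in>P. L p) \<and>
    natoms k m \<and> vdim D K = enat k \<and> (\<forall>r. r \<in> L m \<longleftrightarrow> (\<forall>x. f * x \<in> L q \<longrightarrow> r * x \<in> L q))"
proof -
  define B where "B = (SOME B. lin_basis D K B)"
  have "lin_basis D K B" unfolding B_def using lin_basis_exists[OF n] by (rule someI_ex)
  then have B: "B \<subseteq> carrier K" "lin_indep D K B" "lin_span D K B = carrier K"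
    by (auto simp: lin_basis_def)
  have fin: "finite B" using lin_indep_bound[OF n B(1,2)] by blast
  obtain m P where P: "finite P" "P \<subseteq> atoms" "\<forall>p\<in>P. similar p q" "L m = (\<Inter>p\<in>P. L p)"
    and m: "natoms (card B) m" "\<And>r. r \<in> L m \<longleftrightarrow> (\<forall>X\<in>B. kills q r X)"
    using lin_indep_annihilator[OF fin B(1,2)] by metis
  have "r \<in> L m \<longleftrightarrow> (\<forall>x. f * x \<in> L q \<longrightarrow> r * x \<in> L q)" for r
  proof
    assume r: "r \<in> L m"
    have "kills q r X" if "X \<in> carrier K" for X
    proof -
      have "X \<in> lin_span D K B" using that B(3) by simp
      then obtain A c where A: "finite A" "A \<subseteq> B" "c \<in> A \<rightarrow> carrier D" "X = (\<Oplus>\<^bsub>K\<^esub>v\<in>A. c v \<odot>\<^bsub>K\<^esub> v)"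
        by (auto simp: lin_span_def)
      show ?thesis unfolding A(4)
        by (rule kills_comb[OF A(1) _ A(3)]) (use A(2) B(1) r m(2) in auto)
    qed
    then show "\<forall>x. f * x \<in> L q \<longrightarrow> r * x \<in> L q"
      by (metis coset_in_ker kills_coset)
  next
    assume "\<forall>x. f * x \<in> L q \<longrightarrow> r * x \<in> L q"
    then show "r \<in> L m"
      unfolding m(2) using B(1) by (auto elim!: carrier_kerE dest!: subsetD simp: kills_coset)
  qed
  moreover have "vdim D K = enat (card B)" using fin by (simp add: vdim_def ecard_def B_def)
  ultimately show ?thesis using P m(1) by blast
qed

end

section \<open>Combining the similarity classes\<close>

lemma natoms_coprime:
  fixes a b :: "'a::two_fir"
  assumes "natoms k a" "natoms l b" "f \<noteq> 0" "f \<in> L a" "f \<in> L b"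
    and no_common: "\<And>p. p \<in> atoms \<Longrightarrow> a \<in> L p \<Longrightarrow> b \<in> L p \<Longrightarrow> False"
  shows "\<exists>m. L m = L a \<inter> L b \<and> natoms (k + l) m"
proof -
  obtain d u v where d: "d = u * a + v * b" "a \<in> L d" "b \<in> L d"
    using left_gcd_lcm[OF assms(4,5,3)] by metis
  obtain j where j: "natoms j d" using natoms_divisor[OF assms(1) d(2)] by metis
  \<comment> \<open>A nonunit gcd would have a last atom, which would be a right factor of both
    \<open>a\<close> and \<open>b\<close>.\<close>
  have "d \<in> ring_units"
  proof (cases j)
    case (Suc i)
    then obtain g p where "p \<in> atoms" "d = g * p" using j natoms.simps(2) by blast
    then show ?thesis using no_common[of p] d(2,3) L_trans by blast
  qed (use j in simp)
  then obtain w where "w * d = 1" by (auto simp: ring_units_def)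
  then have "(w * u) * a + (w * v) * b = 1" using d(1) by (simp add: algebra_simps)
  then obtain b' where b': "L (b' * a) = L a \<inter> L b" "rmult_iso b' b a"
    using coprime_lcm[OF assms(3-5)] by metis
  then have "natoms l b'" using rmult_iso_inverse rmult_iso_natoms assms(2) by metis
  then have "natoms (k + l) (b' * a)" using natoms_mult[of l b' k a] assms(1) by (simp add: add.commute)
  then show ?thesis using b' by blast
qed

text \<open>By \<open>atom_dvd_lcm_similar\<close>, a common atomic right factor of
  \<open>m j\<close> and of the least common left multiple of the earlier \<open>m i\<close> would
  be similar to \<open>qs ! j\<close> and to some earlier \<open>qs ! i\<close>, which is excluded.
  So \<open>natoms_coprime\<close> adds the lengths class by class.\<close>

lemma sum_vdim_ker_lambda:
  fixes f :: "'a::two_fir"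
  assumes n: "natoms n f" and qs: "similarity_decomp f qs"
  shows "\<exists>m k. L m = (\<Inter>p\<in>V_atoms f. L p) \<and> natoms k m \<and>
    (\<Sum>i<length qs. vdim (C_ring (qs ! i)) (ker_lambda f (qs ! i))) = enat k"
proof -
  have f: "f \<noteq> 0" using n natoms_nonzero by blast
  have atom: "qs ! i \<in> atoms" if "i < length qs" for i
    using qs that by (auto simp: similarity_decomp_def)
  have "\<forall>i<length qs. \<exists>m k P. finite P \<and> P \<subseteq> atoms \<and> (\<forall>p\<in>P. similar p (qs ! i)) \<and>
      L m = (\<Inter>p\<in>P. L p) \<and> natoms k m \<and> vdim (C_ring (qs ! i)) (ker_lambda f (qs ! i)) = enat k \<and>
      (\<forall>r. r \<in> L m \<longleftrightarrow> (\<forall>x. f * x \<in> L (qs ! i) \<longrightarrow> r * x \<in> L (qs ! i)))"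
    using vdim_ker_lambda[OF f atom n] by blast
  then obtain m k P where *: "\<forall>i<length qs. finite (P i) \<and> P i \<subseteq> atoms \<and> (\<forall>p\<in>P i. similar p (qs ! i)) \<and>
      L (m i) = (\<Inter>p\<in>P i. L p) \<and> natoms (k i) (m i) \<and>
      vdim (C_ring (qs ! i)) (ker_lambda f (qs ! i)) = enat (k i) \<and>
      (\<forall>r. r \<in> L (m i) \<longleftrightarrow> (\<forall>x. f * x \<in> L (qs ! i) \<longrightarrow> r * x \<in> L (qs ! i)))"
    unfolding choice_iff' by blast
  then have P: "finite (P i)" "P i \<subseteq> atoms" "\<And>p. p \<in> P i \<Longrightarrow> similar p (qs ! i)" "L (m i) = (\<Inter>p\<in>P i. L p)"
    and m: "natoms (k i) (m i)" "vdim (C_ring (qs ! i)) (ker_lambda f (qs ! i)) = enat (k i)"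
      "\<And>r. r \<in> L (m i) \<longleftrightarrow> (\<forall>x. f * x \<in> L (qs ! i) \<longrightarrow> r * x \<in> L (qs ! i))"
    if "i < length qs" for i
    using that by blast+
  have fm: "f \<in> L (m i)" if "i < length qs" for i using m(3)[OF that] by blast
  have "\<exists>a. L a = (\<Inter>i\<in>{..<j}. L (m i)) \<and> natoms (\<Sum>i<j. k i) a" if "j \<le> length qs" for j
    using that
  proof (induction j)
    case 0
    show ?case by (intro exI[of _ 1]) simp
  next
    case (Suc j)
    then obtain a where a: "L a = (\<Inter>i\<in>{..<j}. L (m i))" "natoms (\<Sum>i<j. k i) a" by auto
    have j: "j < length qs" using Suc.prems by simp
    have fa: "f \<in> L a" using a(1) fm j by auto
    have aP: "L a = (\<Inter>p\<in>(\<Union>i<j. P i). L p)" using a(1) P(4) j by auto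
    have no_common: False if p: "p \<in> atoms" "a \<in> L p" "m j \<in> L p" for p
    proof -
      have "finite (\<Union>i<j. P i)" using P(1) j by auto
      moreover have "(\<Union>i<j. P i) \<subseteq> atoms" using P(2) j by (meson UN_least lessThan_iff order_less_trans)
      ultimately obtain p1 t where p1: "p1 \<in> (\<Union>i<j. P i)" "rmult_iso p1 p t"
        using atom_dvd_lcm_similar[OF _ _ aP natoms_nonzero[OF a(2)] p(1,2)] by blast
      then obtain i where i: "i < j" "p1 \<in> P i" by blast
      obtain p2 t' where p2: "p2 \<in> P j" "rmult_iso p2 p t'"
        using atom_dvd_lcm_similar[OF P(1,2,4)[OF j] natoms_nonzero[OF m(1)[OF j]] p(1,3)] by blast
      have "similar p1 p" "similar p2 p"
        using p1 p2 i j P(2) p(1) by (meson order_less_trans rmult_iso_similar subsetD)+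
      moreover have "similar p1 (qs ! i)" "similar p2 (qs ! j)" using P(3) i j p2 by auto
      ultimately have "similar (qs ! i) (qs ! j)" by (meson similar_sym similar_trans)
      then show False using qs i j by (auto simp: similarity_decomp_def)
    qed
    obtain b where "L b = L a \<inter> L (m j)" "natoms ((\<Sum>i<j. k i) + k j) b"
      using natoms_coprime[OF a(2) m(1)[OF j] f fa fm[OF j]] no_common by blast
    then show ?case using a(1) by (intro exI[of _ b]) (auto simp: lessThan_Suc add.commute)
  qed
  then obtain a where a: "L a = (\<Inter>i\<in>{..<length qs}. L (m i))" "natoms (\<Sum>i<length qs. k i) a" by blast
  \<comment> \<open>The atoms p of V(f) similar to \<open>qs ! i\<close> are exactly those for which
    Rp is the annihilator of a nonzero vector of the i-th kernel.\<close>
  have "(\<Inter>i\<in>{..<length qs}. L (m i)) = (\<Inter>p\<in>V_atoms f. L p)"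
  proof (intro equalityI subsetI INT_I)
    fix z p assume z: "z \<in> (\<Inter>i\<in>{..<length qs}. L (m i))" and p: "p \<in> V_atoms f"
    then obtain i where i: "i < length qs" "similar (qs ! i) p"
      using qs unfolding similarity_decomp_def similarity_class_def by blast
    then obtain t where t: "rmult_iso p (qs ! i) t" using similar_sym similar_iff by blast
    have "f * t \<in> L (qs ! i)" using p rmult_iso_D[OF t] by (simp add: V_atoms_iff)
    then have "z * t \<in> L (qs ! i)" using z m(3)[OF i(1)] i(1) by blast
    then show "z \<in> L p" using rmult_iso_D[OF t] by blast
  next
    fix z i assume z: "z \<in> (\<Inter>p\<in>V_atoms f. L p)" and "i \<in> {..<length qs}"
    then have i: "i < length qs" by simp
    have "z * x \<in> L (qs ! i)" if fx: "f * x \<in> L (qs ! i)" for x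
    proof (cases "x \<in> L (qs ! i)")
      case False
      then obtain p where p: "p \<in> atoms" "rmult_iso p (qs ! i) x"
        using atom_colon[OF f fx atom[OF i]] by metis
      then have "p \<in> V_atoms f" using fx rmult_iso_D[OF p(2)] by (simp add: V_atoms_iff)
      then show ?thesis using z rmult_iso_D[OF p(2)] by blast
    qed (rule L_mult_left)
    then show "z \<in> L (m i)" using m(3)[OF i] by blast
  qed
  moreover have "(\<Sum>i<length qs. vdim (C_ring (qs ! i)) (ker_lambda f (qs ! i))) = (\<Sum>i<length qs. enat (k i))"
    by (rule sum.cong) (auto simp: m(2))
  then have "(\<Sum>i<length qs. vdim (C_ring (qs ! i)) (ker_lambda f (qs ! i))) = enat (\<Sum>i<length qs. k i)"
    by (simp flip: of_nat_eq_enat)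
  ultimately show ?thesis using a by metis
qed

lemma similarity_representatives:
  fixes B :: "'a::two_fir set"
  assumes "finite B" "0 \<notin> B"
  shows "\<exists>qs. set qs \<subseteq> B \<and> sorted_wrt (\<lambda>x y. \<not> similar x y) qs \<and> (\<forall>b\<in>B. \<exists>q\<in>set qs. similar q b)"
  using assms
proof (induction B rule: finite_induct)
  case (insert b B)
  then obtain qs where qs: "set qs \<subseteq> B" "sorted_wrt (\<lambda>x y. \<not> similar x y) qs"
    "\<forall>b\<in>B. \<exists>q\<in>set qs. similar q b"
    by auto
  show ?case
  proof (cases "\<exists>q\<in>set qs. similar q b")
    case True
    then show ?thesis using qs by (intro exI[of _ qs]) auto
  next
    case False
    then have "\<forall>q\<in>set qs. \<not> similar b q" using similar_sym by blast
    then show ?thesis using qs similar_refl[of b] insert.prems by (intro exI[of _ "b # qs"]) auto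
  qed
qed simp

text \<open>V(f) may be infinite, but each member right-divides the least common left multiple of a
  finite independent \<open>B\<close> and is therefore similar to a member of \<open>B\<close>.
  Finitely many representatives from \<open>B\<close> suffice.\<close>

lemma similarity_decomp_exists:
  fixes f :: "'a::two_fir"
  assumes n: "natoms n f"
  shows "\<exists>qs. similarity_decomp f qs"
proof -
  obtain B m where B: "B \<subseteq> V_atoms f" "independent_atoms B m" "L m = (\<Inter>p\<in>V_atoms f. L p)"
    using independent_V_atoms[OF n] by metis
  then have fin: "finite B" "B \<subseteq> atoms" "L m = (\<Inter>p\<in>B. L p)" and "natoms (card B) m"
    by (auto simp: independent_atoms_def)
  then have "m \<noteq> 0" using natoms_nonzero by blast
  have "0 \<notin> B" using fin(2) atoms_nonzero by blast
  then obtain qs where qs: "set qs \<subseteq> B" "sorted_wrt (\<lambda>x y. \<not> similar x y) qs"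
    "\<forall>b\<in>B. \<exists>q\<in>set qs. similar q b"
    using similarity_representatives[OF fin(1)] by blast
  have cover: "\<exists>i<length qs. similar (qs ! i) p" if p: "p \<in> V_atoms f" for p
  proof -
    have "p \<in> atoms" "m \<in> L p" using p B(3) L_self[of m] by (auto simp: V_atoms_iff)
    then obtain b t where b: "b \<in> B" "rmult_iso b p t"
      using atom_dvd_lcm_similar[OF fin \<open>m \<noteq> 0\<close>] by blast
    then have "similar b p" using rmult_iso_similar fin(2) \<open>p \<in> atoms\<close> by blast
    then show ?thesis using qs(3) b(1) similar_trans by (metis in_set_conv_nth)
  qed
  have "\<not> similar (qs ! i) (qs ! j)" if "i < length qs" "j < length qs" "i \<noteq> j" for i j
  proof (cases "i < j")
    case True
    then show ?thesis using qs(2) that by (simp add: sorted_wrt_iff_nth_less)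
  next
    case False
    then have "\<not> similar (qs ! j) (qs ! i)" using qs(2) that by (simp add: sorted_wrt_iff_nth_less)
    then show ?thesis using similar_sym by blast
  qed
  moreover have "qs ! i \<in> V_atoms f \<inter> similarity_class (qs ! i)" if "i < length qs" for i
  proof -
    have "qs ! i \<in> B" using qs(1) that by auto
    then show ?thesis using B(1) fin(2) atoms_nonzero similar_refl by (auto simp: similarity_class_def)
  qed
  moreover have "set qs \<subseteq> atoms" using qs(1) fin(2) by blast
  moreover have "V_atoms f = (\<Union>i<length qs. V_atoms f \<inter> similarity_class (qs ! i))"
    using cover by (auto simp: similarity_class_def)
  ultimately have "similarity_decomp f qs"
    unfolding similarity_decomp_def by (metis empty_iff)
  then show ?thesis by blast
qed

section \<open>The equivalences\<close>

theorem theorem5p8: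
  fixes f :: "'a::two_fir"
  assumes "f \<in> finite_length"
  shows
    "(\<exists>qs. similarity_decomp f qs) \<and>
     (\<forall>qs. similarity_decomp f qs \<longrightarrow> (\<forall>q\<in>set qs. skew_field (C_ring q))) \<and>
     (fully_reducible f \<longleftrightarrow> rk (V_atoms f) = atom_length f) \<and>
     (fully_reducible f \<longleftrightarrow>
        (\<forall>qs. similarity_decomp f qs \<longrightarrow>
           atom_length f = (\<Sum>i<length qs. vdim (C_ring (qs ! i)) (ker_lambda f (qs ! i))))) \<and>
     (fully_reducible f \<longleftrightarrow>
        (\<exists>ps. set ps \<subseteq> atoms \<and> lmod_iso (quot_mod f) (direct_sum (map quot_mod ps)))) \<and>
     (fully_reducible f \<longleftrightarrow> (\<forall>g. is_factor g f \<longrightarrow> fully_reducible g)) \<and>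
     (fully_reducible f \<longleftrightarrow> (\<forall>g h. neighbouring f g h \<longrightarrow> fully_reducible (g * h))) \<and>
     (fully_reducible f \<longleftrightarrow>
        (\<forall>g\<in>atoms. \<forall>h\<in>atoms. neighbouring f g h \<longrightarrow> fully_reducible (g * h))) \<and>
     (fully_reducible f \<longleftrightarrow> (\<forall>g. g \<noteq> 0 \<and> V_atoms f \<subseteq> V_atoms g \<longrightarrow> g \<in> left_ideal_of f))"
    (is "?decomp \<and> ?skew \<and> (?fr \<longleftrightarrow> ?rank) \<and> (?fr \<longleftrightarrow> ?dim) \<and> (?fr \<longleftrightarrow> ?sum) \<and> (?fr \<longleftrightarrow> ?factors) \<and>
      (?fr \<longleftrightarrow> ?pairs) \<and> (?fr \<longleftrightarrow> ?atom_pairs) \<and> (?fr \<longleftrightarrow> ?V)")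
proof -
  obtain n where n: "natoms n f" using assms finite_length_iff by blast
  have len: "atom_length f = enat n" using n by (rule atom_length_natoms)
  have decomp: ?decomp using n by (rule similarity_decomp_exists)
  have skew: ?skew using skew_field_C_ring by (auto simp: similarity_decomp_def)
  have rank: "?fr \<longleftrightarrow> ?rank"
    using rk_V_atoms[OF n] fully_reducible_iff_natoms[OF n] len by auto
  have "?fr \<longleftrightarrow> atom_length f = (\<Sum>i<length qs. vdim (C_ring (qs ! i)) (ker_lambda f (qs ! i)))"
    if "similarity_decomp f qs" for qs
    using sum_vdim_ker_lambda[OF n that] fully_reducible_iff_natoms[OF n] len by auto
  \<comment> \<open>(iii) ranges over all decompositions and would hold vacuously if there were
    none.\<close>
  with decomp have dim: "?fr \<longleftrightarrow> ?dim" by blast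
  have sum: "?fr \<longleftrightarrow> ?sum" using fully_reducible_direct_sum fully_reducible_if_embeds[OF n] by metis
  \<comment> \<open>(i), (v), (vi), (vii) are closed into a cycle; (v) gives (vi) because a product
    of neighbouring factors is again a factor.\<close>
  have "?fr \<Longrightarrow> ?factors" using fully_reducible_factor by (auto simp: is_factor_def)
  moreover have "?factors \<Longrightarrow> ?pairs"
    unfolding neighbouring_def is_factor_def by (metis mult.assoc mult_in_ring_units_iff)
  moreover have "?pairs \<Longrightarrow> ?atom_pairs" by blast
  moreover have "?atom_pairs \<Longrightarrow> ?fr"
  proof (rule fully_reducible_if_neighbouring_atoms[OF n])
    fix p g h r assume R: ?atom_pairs and gh: "g \<in> atoms" "h \<in> atoms" "f = p * g * h * r"
    have "is_factor g f" "is_factor h f"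
      using gh atoms_nonunit unfolding is_factor_def by (metis mult.assoc)+
    then show "fully_reducible (g * h)" using R gh by (auto simp: neighbouring_def)
  qed
  moreover have "?fr \<longleftrightarrow> ?V" using n by (rule fully_reducible_iff_V_atoms_subset)
  ultimately show ?thesis using decomp skew rank dim sum by argo
qed

end
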